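(* Let $H$ be a real Hilbert space, let $F:H\to 2^H$ and $G:H\to H$, and let $\mu_F,\mu_G\in\mathbb{R}$, $L>0$, $\gamma\in\left(0,\frac{1}{2L}\right)$, $\theta_1,\theta_2\in\mathbb{R}$ be such that: (1) $F$ is maximal $\mu_F$-monotone; (2) $G$ is $\mu_G$-monotone and Lipschitz continuous with constant $L$; (3) $\mu_F+\mu_G\ge 0$; (4) $\mathrm{zer}(F+G)\neq\emptyset$; (5) $0\le\theta_1<\frac13(1-2\gamma L)$ and $\frac{1}{3+4\theta_1}\left(3\theta_1-1+2\gamma L\right)<\theta_2\le 0$; (6) $1+\gamma\mu_F>0$. Let $\{\lambda_k\}_{k\ge1}\subseteq(0,1)$ satisfy $\lim_{k\to\infty}\lambda_k=0$ and $\sum_{k=1}^\infty\lambda_k=\infty$. Let $w^*,u_{-1},u_0,u_1\in H$ be arbitrary and define, for all $k\ge1$, $$w_k=u_k+\theta_1(u_k-u_{k-1})+\theta_2(u_{k-1}-u_{k-2}),$$ $$u_{k+1}=J_{\gamma F}\Big(\lambda_k w^*+(1-\lambda_k)w_k-\gamma Gu_k-\gamma(1-\lambda_k)(Gu_k-Gu_{k-1})\Big).$$ Then the sequence $\{u_k\}$ converges strongly (in norm) to $P_{\mathrm{zer}(F+G)}w^*$.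
   Context: For $\mu\in\mathbb{R}$ (possibly negative), an operator $F:H\to 2^H$ is $\mu$-monotone if $\langle x-y,u-v\rangle\ge\mu\|x-y\|^2$ for all $x,y\in H$, $u\in F(x)$, $v\in F(y)$. A $\mu$-monotone operator is maximal $\mu$-monotone if there is no $\mu$-monotone operator whose graph strictly contains its graph, where the graph of $F$ is $\{(x,u)\in H\times H: u\in F(x)\}$. A single-valued $G:H\to H$ is regarded as the set-valued operator $x\mapsto\{G(x)\}$. $\mathrm{zer}(F+G)=\{x\in H: 0\in F(x)+G(x)\}$. The resolvent is $J_{\gamma F}=(\mathrm{Id}+\gamma F)^{-1}$; under assumptions (1) and (6) it is single-valued and defined on all of $H$. $P_K w$ denotes the metric projection of $w$ onto the nonempty closed convex set $K$, i.e. the unique point of $K$ nearest to $w$. *)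

theory Defs
  imports "HOL-Analysis.Analysis" "HOL-Library.Set_Algebras"
begin

text \<open>
  A set-valued operator on \<open>H\<close> is a function \<open>'a \<Rightarrow> 'a set\<close>, where the real Hilbert space \<open>H\<close>
  is a type of sort \<open>{real_inner, complete_space}\<close>. Sums such as \<open>A x + B x\<close> of values are
  Minkowski sums.
\<close>

definition op_graph :: "('a \<Rightarrow> 'a set) \<Rightarrow> ('a \<times> 'a) set" where
  "op_graph F = {(x, u). u \<in> F x}"

definition mu_monotone :: "real \<Rightarrow> ('a::real_inner \<Rightarrow> 'a set) \<Rightarrow> bool" where
  "mu_monotone \<mu> F \<longleftrightarrow>
     (\<forall>x y. \<forall>u\<in>F x. \<forall>v\<in>F y. (x - y) \<bullet> (u - v) \<ge> \<mu> * (norm (x - y))\<^sup>2)"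

definition maximal_mu_monotone :: "real \<Rightarrow> ('a::real_inner \<Rightarrow> 'a set) \<Rightarrow> bool" where
  "maximal_mu_monotone \<mu> F \<longleftrightarrow>
     mu_monotone \<mu> F \<and> \<not> (\<exists>F'. mu_monotone \<mu> F' \<and> op_graph F \<subset> op_graph F')"

definition op_single :: "('a \<Rightarrow> 'a) \<Rightarrow> 'a \<Rightarrow> 'a set" where
  "op_single G = (\<lambda>x. {G x})"

definition op_add :: "('a::real_vector \<Rightarrow> 'a set) \<Rightarrow> ('a \<Rightarrow> 'a set) \<Rightarrow> 'a \<Rightarrow> 'a set" where
  "op_add A B = (\<lambda>x. A x + B x)"

definition op_scale :: "real \<Rightarrow> ('a::real_vector \<Rightarrow> 'a set) \<Rightarrow> 'a \<Rightarrow> 'a set" where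
  "op_scale c A = (\<lambda>x. (\<lambda>u. c *\<^sub>R u) ` A x)"

definition op_inverse :: "('a \<Rightarrow> 'a set) \<Rightarrow> 'a \<Rightarrow> 'a set" where
  "op_inverse A = (\<lambda>u. {x. u \<in> A x})"

definition zer :: "('a::real_vector \<Rightarrow> 'a set) \<Rightarrow> 'a set" where
  "zer A = {x. 0 \<in> A x}"

text \<open>
  The resolvent is in general set-valued. Where it is single-valued, its value at \<open>y\<close> is
  \<open>the_elem (resolvent A y)\<close>.
\<close>

definition resolvent :: "('a::real_vector \<Rightarrow> 'a set) \<Rightarrow> 'a \<Rightarrow> 'a set" where
  "resolvent A = op_inverse (op_add (op_single id) A)"

text \<open>The library constant \<^const>\<open>closest_point\<close> is restricted to Heine--Borel spaces.\<close>

definition metric_proj :: "'a::metric_space set \<Rightarrow> 'a \<Rightarrow> 'a" where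
  "metric_proj K w = (THE p. p \<in> K \<and> (\<forall>q\<in>K. dist w p \<le> dist w q))"

end

theory Submission
  imports Defs
begin

text \<open>
  Let \<open>p\<close> be the projection of \<open>wstar\<close> onto the set of zeros, \<open>t = - \<theta>2\<close>, \<open>q = \<gamma> L\<close> and
  \<open>g\<^sub>k = \<gamma> (G u\<^sub>k - G u\<^sub>k\<^sub>-\<^sub>1)\<close>. Testing the inclusion that defines the next iterate against \<open>p\<close>
  shows that the energy
  \<open>|u\<^sub>k - p|\<^sup>2 - \<theta>1 |u\<^sub>k\<^sub>-\<^sub>1 - p|\<^sup>2 + t |u\<^sub>k\<^sub>-\<^sub>2 - p|\<^sup>2 - 2 g\<^sub>k \<bullet> (u\<^sub>k - p) + \<dots>\<close>,
  completed by suitable multiples of the last two squared increments, contracts by the factor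
  \<open>1 - \<lambda>\<^sub>k\<close> in each step, up to the error \<open>2 \<lambda>\<^sub>k (wstar - p) \<bullet> (u\<^sub>k\<^sub>+\<^sub>1 - p)\<close> and with a gain
  proportional to the squared increments. If the increments are small, \<open>u\<^sub>k\<^sub>+\<^sub>1\<close> is an approximate
  zero, so demiclosedness makes the error at most \<open>\<lambda>\<^sub>k \<epsilon>\<close>; if they are not, the gain absorbs
  the error. Hence the energy tends to 0.

  The resolvent is everywhere defined by Minty's theorem, and Minty's theorem as well as
  demiclosedness come from the fact that a directed family of nonempty bounded closed convex sets
  in a Hilbert space has a common point, which replaces weak compactness.
\<close>

subsection \<open>Convex sets in Hilbert spaces and Minty's theorem\<close>

text \<open>Packages the limit \<open>r \<rightarrow> 0\<close>, mostly for first-order optimality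
  arguments, where division by the step length \<open>r\<close> leaves a remainder proportional to
  \<open>r\<close>.\<close>

lemma nonpos_if_le_all_multiples:
  fixes a b :: real
  assumes "\<And>r. 0 < r \<Longrightarrow> r \<le> 1 \<Longrightarrow> a \<le> r * b"
  shows "a \<le> 0"
proof -
  have "((\<lambda>r. r * b) \<longlongrightarrow> 0 * b) (at_right 0)"
    by (intro tendsto_intros)
  moreover have "\<forall>\<^sub>F r in at_right 0. a \<le> r * b"
    using eventually_at_right_real[of 0 1] by (rule eventually_mono) (auto intro: assms)
  ultimately have "a \<le> 0 * b"
    by (intro tendsto_lowerbound) auto
  then show ?thesis by simp
qed

text \<open>By the parallelogram identity, two vectors of norm about \<open>s\<close> whose midpoint
  also has norm about \<open>s\<close> must be close. This is the uniform convexity behind the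
  Cauchy estimate below.\<close>

lemma parallelogram_diff_bound:
  fixes x y :: "'a::real_inner"
  assumes "norm x \<le> s + e" "norm y \<le> s + e" "s - e \<le> norm ((1/2) *\<^sub>R (x + y))" "0 \<le> s" "0 \<le> e"
  shows "(norm (x - y))\<^sup>2 \<le> 16 * s * e + 4 * e\<^sup>2"
proof -
  define m where "m = norm ((1/2) *\<^sub>R (x + y))"
  have m: "(norm (x + y))\<^sup>2 = 4 * m\<^sup>2"
    by (simp add: m_def power_mult_distrib power_divide)
  have "(norm (x - y))\<^sup>2 = 2 * (norm x)\<^sup>2 + 2 * (norm y)\<^sup>2 - (norm (x + y))\<^sup>2"
    by (simp add: power2_norm_eq_inner inner_simps inner_commute)
  moreover have "(norm x)\<^sup>2 \<le> (s + e)\<^sup>2" "(norm y)\<^sup>2 \<le> (s + e)\<^sup>2"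
    using assms by (auto intro: power_mono)
  moreover have "s\<^sup>2 - 2 * s * e \<le> m\<^sup>2"
  proof (cases "e \<le> s")
    case True
    then have "(s - e)\<^sup>2 \<le> m\<^sup>2"
      using assms by (intro power_mono) (auto simp: m_def)
    then show ?thesis unfolding power2_diff using zero_le_power2[of e] by linarith
  next
    \<comment> \<open>Here \<open>s - e\<close> is negative and the midpoint bound cannot be
      squared, but the left-hand side is then at most 0.\<close>
    case False
    then have "s * s \<le> s * e" using assms by (intro mult_left_mono) auto
    moreover have "0 \<le> s * s" "0 \<le> m\<^sup>2" by auto
    ultimately show ?thesis unfolding power2_eq_square by linarith
  qed
  ultimately show ?thesis
    using m by (simp add: power2_sum)
qed

text \<open>The distances of the members from the origin have a finite supremum \<open>s\<close>. In
  a member \<open>A i\<close> whose distance exceeds \<open>s - e i\<close>, the points of norm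
  below \<open>s + e i\<close> are within \<open>b i\<close> of each other, and every other member
  has a point within \<open>b i\<close> of the chosen \<open>x i\<close>, because a common
  refinement also contains points of such norm. Hence \<open>x\<close> is Cauchy and its limit lies
  in all members.\<close>

lemma directed_convex_Inter_nonempty:
  fixes K :: "'a::{real_inner, complete_space} set set"
  assumes ne: "K \<noteq> {}"
    and K: "\<And>A. A \<in> K \<Longrightarrow> closed A \<and> convex A \<and> A \<noteq> {} \<and> A \<subseteq> cball 0 R"
    and dir: "\<And>A B. A \<in> K \<Longrightarrow> B \<in> K \<Longrightarrow> \<exists>C\<in>K. C \<subseteq> A \<inter> B"
  shows "\<Inter>K \<noteq> {}"
proof -
  define n where "n = (\<lambda>A::'a set. infdist 0 A)"
  define s where "s = Sup (n ` K)"
  define e where "e = (\<lambda>i::nat. inverse (real (Suc i)))"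
  define b where "b = (\<lambda>i. sqrt (16 * s * e i + 4 * (e i)\<^sup>2))"
  have nR: "n A \<le> R" if AK: "A \<in> K" for A
  proof -
    obtain a where "a \<in> A" "norm a \<le> R" using K[OF AK] by (metis all_not_in_conv mem_cball_0 subset_iff)
    then show ?thesis unfolding n_def by (intro infdist_le2[of a]) auto
  qed
  have bdd: "bdd_above (n ` K)" using nR by (intro bdd_aboveI2)
  have ns: "n A \<le> s" if "A \<in> K" for A
    unfolding s_def using bdd that by (intro cSup_upper) auto
  have s0: "0 \<le> s" using ne ns infdist_nonneg[of 0] unfolding n_def by (meson ex_in_conv order_trans)
  have e0: "e i > 0" for i by (simp add: e_def)
  have e_lim: "e \<longlonglongrightarrow> 0" unfolding e_def by (rule LIMSEQ_inverse_real_of_nat)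
  have "b \<longlonglongrightarrow> sqrt (16 * s * 0 + 4 * 0\<^sup>2)"
    unfolding b_def by (intro tendsto_intros e_lim)
  then have b_lim: "b \<longlonglongrightarrow> 0" by simp
  have near: "\<exists>z\<in>A. norm z < s + r" if "A \<in> K" "r > 0" for A r
  proof -
    have "infdist 0 A < s + r" using ns[OF that(1)] that(2) by (simp add: n_def)
    then show ?thesis using K[OF that(1)]
      by (auto simp: infdist_def cINF_less_iff[OF _ bdd_belowI2[of _ 0]] split: if_splits)
  qed
  have dist_le: "norm (x - y) \<le> b i"
    if "A \<in> K" "x \<in> A" "y \<in> A" "s - e i < n A" "norm x < s + e i" "norm y < s + e i" for x y A i
  proof -
    have "(1/2) *\<^sub>R (x + y) \<in> A"
      using convexD[of A x y "1/2" "1/2"] K that by (auto simp: scaleR_right_distrib)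
    then have "n A \<le> norm ((1/2) *\<^sub>R (x + y))"
      unfolding n_def using infdist_le[of _ A 0] by (metis dist_0_norm)
    then have "(norm (x - y))\<^sup>2 \<le> 16 * s * e i + 4 * (e i)\<^sup>2"
      using that e0[of i] s0 by (intro parallelogram_diff_bound) auto
    then show ?thesis unfolding b_def by (rule real_le_rsqrt)
  qed
  have "\<exists>A\<in>K. s - e i < n A" for i
    using less_cSup_iff[of "n ` K" "s - e i"] ne bdd e0[of i] by (auto simp: s_def)
  then obtain A where A: "\<And>i. A i \<in> K" "\<And>i. s - e i < n (A i)" by metis
  have "\<exists>z\<in>A i. norm z < s + e i" for i using near A e0 by blast
  then obtain x where x: "\<And>i. x i \<in> A i" "\<And>i. norm (x i) < s + e i" by metis
  have approx: "\<exists>z\<in>C. norm (z - x i) \<le> b i" if C: "C \<in> K" for C i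
  proof -
    obtain D where D: "D \<in> K" "D \<subseteq> C \<inter> A i" using dir[OF C A(1)[of i]] by blast
    obtain z where "z \<in> D" "norm z < s + e i" using near[OF D(1) e0[of i]] by blast
    then show ?thesis using D x A dist_le[of "A i" z "x i" i] by blast
  qed
  have cauchy: "norm (x i - x j) \<le> b i + b j" for i j
  proof -
    obtain D where D: "D \<in> K" "D \<subseteq> A i \<inter> A j" using dir[OF A(1)[of i] A(1)[of j]] by blast
    \<comment> \<open>The minimum makes \<open>z\<close> an admissible comparison point for both
      \<open>i\<close> and \<open>j\<close>.\<close>
    obtain z where z: "z \<in> D" "norm z < s + min (e i) (e j)" using near[OF D(1), of "min (e i) (e j)"] e0 by auto
    have "norm (x i - z) \<le> b i" "norm (z - x j) \<le> b j"
      using z D x A dist_le[of "A i" "x i" z i] dist_le[of "A j" z "x j" j] by auto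
    then show ?thesis using norm_triangle_ineq[of "x i - z" "z - x j"] by simp
  qed
  have "Cauchy x"
  proof (rule CauchyI)
    fix r :: real assume "0 < r"
    then obtain M where M: "\<And>i. i \<ge> M \<Longrightarrow> \<bar>b i\<bar> < r / 2"
      using LIMSEQ_D[OF b_lim, of "r/2"] by auto
    have "norm (x i - x j) < r" if "i \<ge> M" "j \<ge> M" for i j
      using cauchy[of i j] M[OF that(1)] M[OF that(2)] by linarith
    then show "\<exists>M. \<forall>m\<ge>M. \<forall>n\<ge>M. norm (x m - x n) < r" by blast
  qed
  then obtain l where l: "x \<longlonglongrightarrow> l"
    using convergent_def Cauchy_convergent by blast
  have "l \<in> C" if C: "C \<in> K" for C
  proof -
    obtain z where z: "\<And>i. z i \<in> C" "\<And>i. norm (z i - x i) \<le> b i" using approx[OF C] by metis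
    have "(\<lambda>i. z i - x i) \<longlonglongrightarrow> 0"
      by (rule Lim_null_comparison[OF _ b_lim]) (use z in auto)
    from tendsto_add[OF this l] have "z \<longlonglongrightarrow> l" by simp
    then show ?thesis using K[OF C] z closed_sequentially by metis
  qed
  then show ?thesis by blast
qed

text \<open>The point \<open>x\<close> is the first component of the maximiser of the concave function
  \<open>(c, d, s) \<mapsto> s - |c|\<^sup>2\<close> over the convex hull of the points \<open>(c, d, |c|\<^sup>2 - |d|\<^sup>2)\<close>.\<close>

lemma finite_cballs_inter_nonempty:
  fixes S :: "('a::real_inner \<times> 'a) set"
  assumes "finite S" and S: "\<And>c d c' d'. (c, d) \<in> S \<Longrightarrow> (c', d') \<in> S \<Longrightarrow> norm (c - c') \<le> norm (d - d')"
  shows "\<exists>x. \<forall>(c, d)\<in>S. norm (x - c) \<le> norm d"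
proof (cases "S = {}")
  case False
  define f where "f = (\<lambda>(c::'a, d::'a). (c, d, (norm c)\<^sup>2 - (norm d)\<^sup>2))"
  define Z where "Z = convex hull (f ` S)"
  define q where "q = (\<lambda>z::'a \<times> 'a \<times> real. snd (snd z) - (norm (fst z))\<^sup>2)"
  \<comment> \<open>For \<open>z = f (c, d)\<close> and \<open>z' = f (c', d')\<close>, the sum
    \<open>h z \<bullet> z' + snd (snd z)\<close> equals \<open>|c - c'|^2 - |d - d'|^2\<close>. It
    is symmetric and affine in each argument, so its sign passes from the points to their hull one
    argument at a time.\<close>
  define h where "h = (\<lambda>z::'a \<times> 'a \<times> real. ((- 2) *\<^sub>R fst z, 2 *\<^sub>R fst (snd z), 1::real))"
  have hsym: "h z \<bullet> z' + snd (snd z) = h z' \<bullet> z + snd (snd z')" for z z'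
    by (simp add: h_def inner_prod_def inner_commute)
  have hS: "h z \<bullet> z' \<le> - snd (snd z)" if zz: "z \<in> f ` S" "z' \<in> f ` S" for z z'
  proof -
    obtain c d c' d' where cd: "(c, d) \<in> S" "(c', d') \<in> S" "z = f (c, d)" "z' = f (c', d')"
      using zz unfolding image_iff by (metis surj_pair)
    have "(norm (c - c'))\<^sup>2 \<le> (norm (d - d'))\<^sup>2" using S cd by (intro power_mono) auto
    then show ?thesis
      by (simp add: cd f_def h_def inner_prod_def power2_norm_eq_inner inner_simps inner_commute)
  qed
  have half: "convex {z'. h z \<bullet> z' \<le> - snd (snd z)}" for z by (rule convex_halfspace_le)
  have hZ1: "h z \<bullet> z' \<le> - snd (snd z)" if "z \<in> f ` S" "z' \<in> Z" for z z'
    using hull_minimal[where S="convex", OF _ half[of z], of "f ` S"] hS that unfolding Z_def by blast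
  have hZ2: "h z \<bullet> z' \<le> - snd (snd z)" if "z \<in> Z" "z' \<in> Z" for z z'
  proof -
    have "h z' \<bullet> y \<le> - snd (snd z')" if "y \<in> f ` S" for y
      using hZ1[OF that \<open>z' \<in> Z\<close>] hsym[of y z'] by linarith
    then have "h z' \<bullet> z \<le> - snd (snd z')"
      using hull_minimal[where S="convex", OF _ half[of z'], of "f ` S"] that unfolding Z_def by blast
    then show ?thesis using hsym[of z z'] by linarith
  qed
  \<comment> \<open>On the diagonal the inequality reads \<open>2 * q z + 2 * |d|^2 \<le> 0\<close>,
    where \<open>d\<close> is the second component of \<open>z\<close>.\<close>
  have q0: "q z \<le> 0" if "z \<in> Z" for z
  proof -
    have "2 * snd (snd z) - 2 * (fst z \<bullet> fst z) + 2 * (fst (snd z) \<bullet> fst (snd z)) \<le> 0"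
      using hZ2[OF that that] by (simp add: h_def inner_prod_def)
    moreover have "0 \<le> fst (snd z) \<bullet> fst (snd z)" by simp
    ultimately show ?thesis
      unfolding q_def power2_norm_eq_inner by linarith
  qed
  have "compact Z" unfolding Z_def using assms by (intro finite_imp_compact_convex_hull) auto
  moreover have "Z \<noteq> {}" using False by (simp add: Z_def)
  moreover have "continuous_on Z q" unfolding q_def by (intro continuous_intros)
  ultimately obtain y where y: "y \<in> Z" "\<And>z. z \<in> Z \<Longrightarrow> q z \<le> q y"
    using continuous_attains_sup[of Z q] by blast
  obtain x e \<sigma> where xe: "y = (x, e, \<sigma>)" by (cases y)
  have "norm (x - c) \<le> norm d" if cd: "(c, d) \<in> S" for c d
  proof -
    define s where "s = (norm c)\<^sup>2 - (norm d)\<^sup>2"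
    have z: "(c, d, s) \<in> Z" 
    proof -
      have "(c, d, s) = f (c, d)" by (simp add: f_def s_def)
      then show ?thesis unfolding Z_def using cd by (metis hull_inc imageI)
    qed
    \<comment> \<open>First-order optimality of \<open>y\<close> in the direction of
      \<open>(c, d, s)\<close>. Combined with \<open>q y \<le> 0\<close>, the limit
      \<open>r \<rightarrow> 0\<close> gives the ball inequality.\<close>
    have "s - \<sigma> - 2 * (x \<bullet> (c - x)) \<le> r * (norm (c - x))\<^sup>2" if r: "0 < r" "r \<le> 1" for r
    proof -
      have "(1 - r) *\<^sub>R y + r *\<^sub>R (c, d, s) \<in> Z"
        using convexD[of Z y "(c,d,s)" "1 - r" r] y z r by (auto simp: Z_def convex_convex_hull)
      from y(2)[OF this] have "r * (s - \<sigma> - 2 * (x \<bullet> (c - x))) \<le> r * (r * (norm (c - x))\<^sup>2)"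
        unfolding xe q_def power2_norm_eq_inner
        by (simp add: inner_simps algebra_simps inner_commute power2_eq_square)
      then show ?thesis using r by simp
    qed
    then have "s - \<sigma> - 2 * (x \<bullet> (c - x)) \<le> 0" by (rule nonpos_if_le_all_multiples)
    then have "(norm (x - c))\<^sup>2 \<le> (norm d)\<^sup>2"
      using q0[OF y(1)] unfolding s_def xe q_def
      by (simp add: power2_norm_eq_inner inner_simps inner_commute)
    then show ?thesis by (rule power2_le_imp_le) simp
  qed
  then show ?thesis by blast
qed simp

text \<open>With \<open>c = (y - v + z) / 2\<close> and \<open>d = (y + v - z) / 2\<close>, monotonicity of \<open>M\<close> says that
  \<open>c \<mapsto> d\<close> is expanding, and \<open>(y - x) \<bullet> (v - (z - x)) \<ge> 0\<close> says that \<open>x\<close> lies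
  in the ball around \<open>c\<close> of radius \<open>|d|\<close>.\<close>

lemma minty_monotonically_related:
  fixes M :: "('a::{real_inner, complete_space} \<times> 'a) set"
  assumes mono: "\<And>y v y' v'. (y, v) \<in> M \<Longrightarrow> (y', v') \<in> M \<Longrightarrow> 0 \<le> (y - y') \<bullet> (v - v')"
  shows "\<exists>x. \<forall>(y, v)\<in>M. 0 \<le> (y - x) \<bullet> (v - (z - x))"
proof (cases "M = {}")
  case False
  then obtain m0 where m0: "m0 \<in> M" by auto
  define c where "c = (\<lambda>(y::'a, v::'a). (1/2) *\<^sub>R (y - v + z))"
  define d where "d = (\<lambda>(y::'a, v::'a). (1/2) *\<^sub>R (y + v - z))"
  have rel: "norm (x - c (y, v)) \<le> norm (d (y, v)) \<longleftrightarrow> 0 \<le> (y - x) \<bullet> (v - (z - x))" for x y v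
  proof -
    have "(norm (d (y, v)))\<^sup>2 - (norm (x - c (y, v)))\<^sup>2 = (y - x) \<bullet> (v - (z - x))"
      by (simp add: c_def d_def power2_norm_eq_inner inner_simps inner_commute field_simps)
    then show ?thesis
      by (metis (no_types) abs_norm_cancel diff_ge_0_iff_ge norm_ge_zero power2_le_iff_abs_le)
  qed
  have expand: "norm (c m - c m') \<le> norm (d m - d m')" if "m \<in> M" "m' \<in> M" for m m'
  proof -
    obtain y v y' v' where m: "m = (y, v)" "m' = (y', v')" by (cases m, cases m')
    have "(norm (d m - d m'))\<^sup>2 - (norm (c m - c m'))\<^sup>2 = (y - y') \<bullet> (v - v')"
      by (simp add: m c_def d_def power2_norm_eq_inner inner_simps inner_commute field_simps)
    then have "(norm (c m - c m'))\<^sup>2 \<le> (norm (d m - d m'))\<^sup>2"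
      using mono[of y v y' v'] that unfolding m by linarith
    then show ?thesis by (rule power2_le_imp_le) simp
  qed
  \<comment> \<open>The ball of \<open>m0\<close> takes part in every intersection, so that all of
    them lie in one common ball.\<close>
  define I where "I = (\<lambda>T. \<Inter>m\<in>insert m0 T. cball (c m) (norm (d m)))"
  define K where "K = I ` {T. finite T \<and> T \<subseteq> M}"
  have "\<Inter>K \<noteq> {}"
  proof (rule directed_convex_Inter_nonempty[where R="norm (c m0) + norm (d m0)"])
    show "K \<noteq> {}" by (auto simp: K_def)
  next
    fix A assume "A \<in> K"
    then obtain T where T: "finite T" "T \<subseteq> M" "A = I T" by (auto simp: K_def)
    have "\<exists>x. \<forall>(c, d)\<in>(\<lambda>m. (c m, d m)) ` insert m0 T. norm (x - c) \<le> norm d"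
      
    proof (rule finite_cballs_inter_nonempty)
      fix a b a' b' assume "(a, b) \<in> (\<lambda>m. (c m, d m)) ` insert m0 T" "(a', b') \<in> (\<lambda>m. (c m, d m)) ` insert m0 T"
      then obtain m m' where "m \<in> insert m0 T" "m' \<in> insert m0 T" "a = c m" "b = d m" "a' = c m'" "b' = d m'"
        by blast
      then show "norm (a - a') \<le> norm (b - b')" using expand T m0 by blast
    qed (use T in simp)
    then obtain x where "\<And>m. m \<in> insert m0 T \<Longrightarrow> norm (x - c m) \<le> norm (d m)" by auto
    then have "x \<in> A" by (auto simp: T I_def dist_norm norm_minus_commute)
    then have "A \<noteq> {}" by blast
    moreover have "closed A" "convex A"
      unfolding T I_def by (intro closed_INT convex_INT ballI closed_cball convex_cball)+
    moreover have "A \<subseteq> cball 0 (norm (c m0) + norm (d m0))"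
    proof
      fix x assume "x \<in> A"
      then have "norm (c m0 - x) \<le> norm (d m0)" by (simp add: T I_def dist_norm)
      then show "x \<in> cball 0 (norm (c m0) + norm (d m0))"
        using norm_triangle_ineq4[of "c m0" "c m0 - x"] by simp
    qed
    ultimately show "closed A \<and> convex A \<and> A \<noteq> {} \<and> A \<subseteq> cball 0 (norm (c m0) + norm (d m0))"
      by blast
  next
    fix A B assume "A \<in> K" "B \<in> K"
    then obtain T U where "A = I T" "B = I U" "finite T" "T \<subseteq> M" "finite U" "U \<subseteq> M"
      by (auto simp: K_def)
    then show "\<exists>C\<in>K. C \<subseteq> A \<inter> B"
      by (intro bexI[of _ "I (T \<union> U)"]) (auto simp: K_def I_def)
  qed
  then obtain x where x: "\<And>T. finite T \<Longrightarrow> T \<subseteq> M \<Longrightarrow> x \<in> I T" by (auto simp: K_def)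
  have "0 \<le> (y - x) \<bullet> (v - (z - x))" if "(y, v) \<in> M" for y v
    using x[of "{(y, v)}"] that rel[of x y v] by (auto simp: I_def dist_norm norm_minus_commute)
  then show ?thesis by blast
qed simp

subsection \<open>Resolvents, zeros and projections\<close>

text \<open>Otherwise the pair \<open>(x, a)\<close> could be added to the graph without destroying
  \<mu>-monotonicity.\<close>

lemma maximal_mu_monotoneD:
  assumes "maximal_mu_monotone \<mu> F"
    and "\<And>y v. v \<in> F y \<Longrightarrow> \<mu> * (norm (y - x))\<^sup>2 \<le> (y - x) \<bullet> (v - a)"
  shows "a \<in> F x"
proof (rule ccontr)
  assume a: "a \<notin> F x"
  define F' where "F' = (\<lambda>y. if y = x then insert a (F y) else F y)"
  have mono: "mu_monotone \<mu> F" using assms by (simp add: maximal_mu_monotone_def)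
  have swap: "\<mu> * (norm (x - y))\<^sup>2 \<le> (x - y) \<bullet> (a - v)" if "v \<in> F y" for y v
    using assms(2)[OF that] by (simp add: norm_minus_commute inner_diff_left inner_diff_right)
  have "mu_monotone \<mu> F'"
    using mono assms(2) swap unfolding mu_monotone_def F'_def by (auto split: if_splits)
  moreover have "op_graph F \<subset> op_graph F'"
  proof (rule psubsetI)
    show "op_graph F \<subseteq> op_graph F'" by (auto simp: op_graph_def F'_def)
    have "(x, a) \<in> op_graph F'" "(x, a) \<notin> op_graph F" using a by (auto simp: op_graph_def F'_def)
    then show "op_graph F \<noteq> op_graph F'" by blast
  qed
  ultimately show False using assms(1) by (auto simp: maximal_mu_monotone_def)
qed

lemma mem_resolvent_op_scale_iff:
  assumes "\<gamma> \<noteq> 0"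
  shows "x \<in> resolvent (op_scale \<gamma> F) z \<longleftrightarrow> (1 / \<gamma>) *\<^sub>R (z - x) \<in> F x"
proof -
  have "z = x + \<gamma> *\<^sub>R v \<longleftrightarrow> v = (1 / \<gamma>) *\<^sub>R (z - x)" for v
  proof
    assume "z = x + \<gamma> *\<^sub>R v"
    then show "v = (1 / \<gamma>) *\<^sub>R (z - x)" using assms by simp
  qed (use assms in simp)
  then show ?thesis
    by (auto simp: resolvent_def op_inverse_def op_add_def op_single_def op_scale_def set_plus_def)
qed

text \<open>\<open>Id + \<gamma> F\<close> is strongly monotone with modulus
  \<open>1 + \<gamma> * \<mu>\<close>, and Cauchy-Schwarz turns this into a bound for the
  inverse.\<close>

lemma resolvent_lipschitz:
  assumes "mu_monotone \<mu> F" "0 < \<gamma>" "0 < 1 + \<gamma> * \<mu>"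
    and "x \<in> resolvent (op_scale \<gamma> F) z" "x' \<in> resolvent (op_scale \<gamma> F) z'"
  shows "(1 + \<gamma> * \<mu>) * norm (x - x') \<le> norm (z - z')"
proof (cases "x = x'")
  case False
  have "\<mu> * (norm (x - x'))\<^sup>2 \<le> (x - x') \<bullet> ((1 / \<gamma>) *\<^sub>R (z - x) - (1 / \<gamma>) *\<^sub>R (z' - x'))"
    using assms unfolding mu_monotone_def by (simp add: mem_resolvent_op_scale_iff)
  also have "\<dots> = ((x - x') \<bullet> (z - z') - (norm (x - x'))\<^sup>2) / \<gamma>"
    unfolding scaleR_diff_right[symmetric] inner_scaleR_right
    by (simp add: power2_norm_eq_inner inner_simps algebra_simps add_divide_distrib diff_divide_distrib)
  finally have "(1 + \<gamma> * \<mu>) * (norm (x - x'))\<^sup>2 \<le> (x - x') \<bullet> (z - z')"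
    using assms(2) by (simp add: field_simps)
  also have "\<dots> \<le> norm (x - x') * norm (z - z')" by (rule norm_cauchy_schwarz)
  finally show ?thesis using False by (simp add: power2_eq_square mult.left_commute)
qed simp

text \<open>\<open>F - \<mu> Id\<close> is monotone, and with
  \<open>k = 1 + \<gamma> * \<mu>\<close> the inclusion \<open>z \<in> x + \<gamma> F x\<close>
  means \<open>z / k \<in> x + (\<gamma> / k) (F x - \<mu> x)\<close>. Minty's lemma for the graph
  \<open>M\<close> of the scaled operator gives a candidate \<open>x\<close>, maximality of
  \<open>F\<close> makes it a solution, and the Lipschitz bound gives uniqueness.\<close>

lemma resolvent_single_valued:
  fixes F :: "'a::{real_inner, complete_space} \<Rightarrow> 'a set"
  assumes F: "maximal_mu_monotone \<mu> F" and \<gamma>: "0 < \<gamma>" and \<kappa>: "0 < 1 + \<gamma> * \<mu>"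
  shows "resolvent (op_scale \<gamma> F) z = {the_elem (resolvent (op_scale \<gamma> F) z)}"
proof -
  define k where "k = 1 + \<gamma> * \<mu>"
  have k: "0 < k" using \<kappa> by (simp add: k_def)
  have mono: "mu_monotone \<mu> F" using F by (simp add: maximal_mu_monotone_def)
  define M where "M = {(y, (\<gamma> / k) *\<^sub>R (v - \<mu> *\<^sub>R y)) | y v. v \<in> F y}"
  have "0 \<le> (y - y') \<bullet> (v - v')" if "(y, v) \<in> M" "(y', v') \<in> M" for y v y' v'
  proof -
    obtain b b' where b: "b \<in> F y" "v = (\<gamma> / k) *\<^sub>R (b - \<mu> *\<^sub>R y)"
      "b' \<in> F y'" "v' = (\<gamma> / k) *\<^sub>R (b' - \<mu> *\<^sub>R y')"
      using \<open>(y, v) \<in> M\<close> \<open>(y', v') \<in> M\<close> by (auto simp: M_def)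
    have "\<mu> * (norm (y - y'))\<^sup>2 \<le> (y - y') \<bullet> (b - b')"
      using mono b unfolding mu_monotone_def by blast
    then have "0 \<le> (\<gamma> / k) * ((y - y') \<bullet> (b - b') - \<mu> * (norm (y - y'))\<^sup>2)"
      using \<gamma> k by simp
    also have "\<dots> = (y - y') \<bullet> (v - v')"
      unfolding b scaleR_diff_right[symmetric] inner_scaleR_right
      by (simp add: power2_norm_eq_inner inner_simps algebra_simps)
    finally show ?thesis .
  qed
  then obtain x where x: "\<And>y v. (y, v) \<in> M \<Longrightarrow> 0 \<le> (y - x) \<bullet> (v - ((1 / k) *\<^sub>R z - x))"
    using minty_monotonically_related[of M "(1 / k) *\<^sub>R z"] by blast
  have "(1 / \<gamma>) *\<^sub>R (z - x) \<in> F x"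
  proof (rule maximal_mu_monotoneD[OF F])
    fix y v assume "v \<in> F y"
    then have "0 \<le> (y - x) \<bullet> ((\<gamma> / k) *\<^sub>R (v - \<mu> *\<^sub>R y) - ((1 / k) *\<^sub>R z - x))"
      by (intro x) (auto simp: M_def)
    \<comment> \<open>Multiplication by \<open>k / \<gamma>\<close> undoes the scaling of
      \<open>M\<close>.\<close>
    then have "0 \<le> (k / \<gamma>) * ((y - x) \<bullet> ((\<gamma> / k) *\<^sub>R (v - \<mu> *\<^sub>R y) - ((1 / k) *\<^sub>R z - x)))"
      using k \<gamma> by simp
    also have "\<dots> = (y - x) \<bullet> ((k / \<gamma>) *\<^sub>R ((\<gamma> / k) *\<^sub>R (v - \<mu> *\<^sub>R y) - ((1 / k) *\<^sub>R z - x)))"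
      by simp
    also have "(k / \<gamma>) *\<^sub>R ((\<gamma> / k) *\<^sub>R (v - \<mu> *\<^sub>R y) - ((1 / k) *\<^sub>R z - x))
        = (v - (1 / \<gamma>) *\<^sub>R (z - x)) - \<mu> *\<^sub>R (y - x)"
    proof -
      have "k / \<gamma> = 1 / \<gamma> + \<mu>" using \<gamma> by (simp add: k_def field_simps)
      moreover have "(k / \<gamma>) *\<^sub>R ((\<gamma> / k) *\<^sub>R (v - \<mu> *\<^sub>R y) - ((1 / k) *\<^sub>R z - x))
        = (v - \<mu> *\<^sub>R y) - ((1 / \<gamma>) *\<^sub>R z - (k / \<gamma>) *\<^sub>R x)"
        using k \<gamma> by (simp add: scaleR_diff_right)
      ultimately show ?thesis by (simp add: algebra_simps)
    qed
    finally show "\<mu> * (norm (y - x))\<^sup>2 \<le> (y - x) \<bullet> (v - (1 / \<gamma>) *\<^sub>R (z - x))"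
      by (simp add: inner_diff_right[of _ _ "\<mu> *\<^sub>R (y - x)"] power2_norm_eq_inner)
  qed
  then have "x \<in> resolvent (op_scale \<gamma> F) z" using \<gamma> by (simp add: mem_resolvent_op_scale_iff)
  moreover have "x' = x''" if "x' \<in> resolvent (op_scale \<gamma> F) z" "x'' \<in> resolvent (op_scale \<gamma> F) z" for x' x''
    using resolvent_lipschitz[OF mono \<gamma> \<kappa> that] \<kappa> by (simp add: mult_le_0_iff)
  ultimately have "resolvent (op_scale \<gamma> F) z = {x}" by blast
  then show ?thesis by simp
qed

lemma zer_op_add_single_iff: "x \<in> zer (op_add F (op_single G)) \<longleftrightarrow> - G x \<in> F x"
proof -
  have "0 = v + G x \<longleftrightarrow> v = - G x" for v by (metis eq_neg_iff_add_eq_0)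
  then show ?thesis by (auto simp: zer_def op_add_def op_single_def set_plus_def)
qed

text \<open>Test \<open>x\<close> against the solution \<open>y\<close> of \<open>0 \<in> F y + G y + c (y - x)\<close>, which exists for large
  \<open>c\<close> by Banach's fixed point theorem.\<close>

lemma mem_zer_if_monotonically_related:
  fixes F :: "'a::{real_inner, complete_space} \<Rightarrow> 'a set"
  assumes F: "maximal_mu_monotone \<mu> F" and G: "L-lipschitz_on UNIV G"
    and x: "\<And>y v. v \<in> F y \<Longrightarrow> 0 \<le> (y - x) \<bullet> (v + G y)"
  shows "x \<in> zer (op_add F (op_single G))"
proof -
  have L: "0 \<le> L" using G by (rule lipschitz_on_nonneg)
  have mono: "mu_monotone \<mu> F" using F by (simp add: maximal_mu_monotone_def)
  \<comment> \<open>Since \<open>c + \<mu> > L\<close>, the resolvent of \<open>F / c\<close> is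
    single-valued and \<open>T\<close> is Lipschitz with constant
    \<open>L / (c + \<mu>) < 1\<close>.\<close>
  define c where "c = L + \<bar>\<mu>\<bar> + 1"
  have c: "0 < c" "L < c + \<mu>" using L by (auto simp: c_def)
  define k where "k = 1 + (1 / c) * \<mu>"
  have k: "0 < k" "L / c < k" using c L by (auto simp: k_def field_simps)
  define z where "z = (\<lambda>y. x - (1 / c) *\<^sub>R G y)"
  define T where "T = (\<lambda>y. the_elem (resolvent (op_scale (1 / c) F) (z y)))"
  have T: "T y \<in> resolvent (op_scale (1 / c) F) (z y)" for y
    using resolvent_single_valued[OF F, of "1 / c"] c k unfolding T_def k_def by fastforce
  have "dist (T y) (T y') \<le> (L / c / k) * dist y y'" for y y'
  proof -
    have "k * norm (T y - T y') \<le> norm (z y - z y')"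
      unfolding k_def using c k(1)[unfolded k_def] by (intro resolvent_lipschitz[OF mono _ _ T T]) auto
    also have "z y - z y' = (1 / c) *\<^sub>R (G y' - G y)" by (simp add: z_def scaleR_diff_right)
    also have "norm \<dots> \<le> (1 / c) * (L * dist y y')"
      using lipschitz_onD[OF G, of y' y] c by (auto simp: dist_norm norm_minus_commute intro: mult_left_mono divide_right_mono)
    finally have "norm (T y - T y') \<le> (1 / c) * (L * dist y y') / k"
      unfolding pos_le_divide_eq[OF k(1)] by (simp only: mult.commute)
    then show ?thesis by (simp add: dist_norm)
  qed
  moreover have "0 \<le> L / c / k" "L / c / k < 1" using k L c divide_less_eq_1_pos[of k "L / c"] by (simp_all only: divide_nonneg_pos)
  ultimately obtain y where y: "T y = y" using banach_fix_type[of "L / c / k" T] by auto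
  have "c *\<^sub>R (z y - y) \<in> F y"
    using T[of y] c by (simp add: y mem_resolvent_op_scale_iff)
  moreover have "c *\<^sub>R (z y - y) = c *\<^sub>R (x - y) - G y" using c by (simp add: z_def algebra_simps)
  ultimately have v: "c *\<^sub>R (x - y) - G y \<in> F y" by simp
  have "0 \<le> (y - x) \<bullet> (c *\<^sub>R (x - y))" using x[OF v] by simp
  also have "\<dots> = - (c * (norm (y - x))\<^sup>2)"
    by (simp add: power2_norm_eq_inner inner_simps algebra_simps)
  finally have "c * (norm (y - x))\<^sup>2 \<le> 0" by simp
  then have "y = x" using c by (simp add: mult_le_0_iff)
  then show ?thesis using v by (simp add: zer_op_add_single_iff)
qed

section \<open>Nearest points of closed convex sets\<close>

text \<open>The intersections of \<open>C\<close> with balls around \<open>w\<close> of radius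
  slightly above the distance are nested, nonempty and bounded. At a common point the distance is
  attained.\<close>

lemma closest_point_exists:
  fixes C :: "'a::{real_inner, complete_space} set"
  assumes C: "closed C" "convex C" "C \<noteq> {}"
  obtains p where "p \<in> C" "\<And>q. q \<in> C \<Longrightarrow> dist w p \<le> dist w q"
proof -
  define K where "K = (\<lambda>r. C \<inter> cball w (infdist w C + r)) ` {0<..1}"
  have "\<Inter>K \<noteq> {}"
  proof (rule directed_convex_Inter_nonempty[where R="norm w + infdist w C + 1"])
    show "K \<noteq> {}" by (auto simp: K_def)
  next
    fix A assume "A \<in> K"
    then obtain r where r: "0 < r" "r \<le> 1" and A: "A = C \<inter> cball w (infdist w C + r)"
      by (auto simp: K_def)
    have "(INF a\<in>C. dist w a) < infdist w C + r" using r C(3) by (simp add: infdist_notempty)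
    then obtain a where "a \<in> C" "dist w a < infdist w C + r"
      using cINF_less_iff[OF C(3) bdd_belowI2[of C 0 "dist w"]] by auto
    then have "a \<in> A" by (simp add: A)
    moreover have "A \<subseteq> cball 0 (norm w + infdist w C + 1)"
    proof
      fix y assume "y \<in> A"
      then have "norm (w - y) \<le> infdist w C + r" by (simp add: A dist_norm)
      then show "y \<in> cball 0 (norm w + infdist w C + 1)"
        using norm_triangle_ineq4[of w "w - y"] r by simp
    qed
    ultimately show "closed A \<and> convex A \<and> A \<noteq> {} \<and> A \<subseteq> cball 0 (norm w + infdist w C + 1)"
      using C by (auto simp: A intro: convex_Int)
  next
    fix A B assume "A \<in> K" "B \<in> K"
    then obtain r r' where "0 < r" "r \<le> 1" "A = C \<inter> cball w (infdist w C + r)"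
      "0 < r'" "r' \<le> 1" "B = C \<inter> cball w (infdist w C + r')"
      by (auto simp: K_def)
    then show "\<exists>D\<in>K. D \<subseteq> A \<inter> B"
      unfolding K_def by (intro bexI[OF _ imageI[of "min r r'"]]) auto
  qed
  then obtain p where p: "\<And>r. 0 < r \<Longrightarrow> r \<le> 1 \<Longrightarrow> p \<in> C \<and> dist w p \<le> infdist w C + r"
    unfolding K_def by fastforce
  have "dist w p - infdist w C \<le> r * 1" if "0 < r" "r \<le> 1" for r using p[OF that] by simp
  then have "dist w p - infdist w C \<le> 0" by (rule nonpos_if_le_all_multiples)
  then have "dist w p \<le> dist w q" if "q \<in> C" for q using infdist_le[OF that, of w] by linarith
  moreover have "p \<in> C" using p[of 1] by simp
  ultimately show thesis using that by blast
qed

text \<open>Moving from \<open>p\<close> towards \<open>q\<close> by a fraction \<open>r\<close>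
  stays in \<open>C\<close> and cannot shorten the distance to \<open>w\<close>; the part linear in
  \<open>r\<close> gives the sign.\<close>

lemma closest_point_obtuse:
  fixes C :: "'a::real_inner set"
  assumes C: "convex C" and p: "p \<in> C" "\<And>q. q \<in> C \<Longrightarrow> dist w p \<le> dist w q" and q: "q \<in> C"
  shows "(w - p) \<bullet> (q - p) \<le> 0"
proof -
  have "2 * ((w - p) \<bullet> (q - p)) \<le> r * (norm (q - p))\<^sup>2" if r: "0 < r" "r \<le> 1" for r
  proof -
    have "(1 - r) *\<^sub>R p + r *\<^sub>R q \<in> C" using convexD[OF C p(1) q, of "1 - r" r] r by simp
    from p(2)[OF this] have "(norm (w - p))\<^sup>2 \<le> (norm (w - ((1 - r) *\<^sub>R p + r *\<^sub>R q)))\<^sup>2"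
      by (simp add: dist_norm)
    also have "w - ((1 - r) *\<^sub>R p + r *\<^sub>R q) = (w - p) - r *\<^sub>R (q - p)" by (simp add: algebra_simps)
    also have "(norm \<dots>)\<^sup>2 = (norm (w - p))\<^sup>2 - 2 * r * ((w - p) \<bullet> (q - p)) + r * r * (norm (q - p))\<^sup>2"
      unfolding power2_norm_eq_inner by (simp add: inner_diff_left[of "w-p"] inner_diff_right[of _ "w-p"] inner_commute)
    finally have "r * (2 * ((w - p) \<bullet> (q - p))) \<le> r * (r * (norm (q - p))\<^sup>2)" by (simp add: algebra_simps)
    then show ?thesis using r by simp
  qed
  from nonpos_if_le_all_multiples[OF this] show ?thesis by simp
qed

lemma metric_proj_props:
  fixes C :: "'a::{real_inner, complete_space} set"
  assumes C: "closed C" "convex C" "C \<noteq> {}"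
  shows "metric_proj C w \<in> C" and "q \<in> C \<Longrightarrow> (w - metric_proj C w) \<bullet> (q - metric_proj C w) \<le> 0"
proof -
  obtain p where p: "p \<in> C" "\<And>q. q \<in> C \<Longrightarrow> dist w p \<le> dist w q"
    using closest_point_exists[OF C] by blast
  have "metric_proj C w = p" unfolding metric_proj_def
  proof (rule the_equality)
    fix p' assume p': "p' \<in> C \<and> (\<forall>q\<in>C. dist w p' \<le> dist w q)"
    \<comment> \<open>The obtuse-angle inequalities of two nearest points add up to
      \<open>|p' - p|^2 \<le> 0\<close>.\<close>
    have "(w - p) \<bullet> (p' - p) \<le> 0" "(w - p') \<bullet> (p - p') \<le> 0"
      using closest_point_obtuse[OF C(2)] p p' by blast+
    moreover have "(w - p) \<bullet> (p' - p) + (w - p') \<bullet> (p - p') = (p' - p) \<bullet> (p' - p)"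
      by (simp add: inner_simps inner_commute)
    ultimately have "(p' - p) \<bullet> (p' - p) \<le> 0" by linarith
    then have "p' - p = 0" using inner_gt_zero_iff[of "p' - p"] by linarith
    then show "p' = p" by simp
  qed (use p in blast)
  then show "metric_proj C w \<in> C" "q \<in> C \<Longrightarrow> (w - metric_proj C w) \<bullet> (q - metric_proj C w) \<le> 0"
    using p closest_point_obtuse[OF C(2) p] by auto
qed

section \<open>The zero set and demiclosedness\<close>

lemma op_add_single_monotone:
  assumes "mu_monotone \<mu>F F" "mu_monotone \<mu>G (op_single G)" "0 \<le> \<mu>F + \<mu>G"
    and "v \<in> F y" "v' \<in> F x"
  shows "0 \<le> (y - x) \<bullet> ((v + G y) - (v' + G x))"
proof -
  have "\<mu>F * (norm (y - x))\<^sup>2 \<le> (y - x) \<bullet> (v - v')" "\<mu>G * (norm (y - x))\<^sup>2 \<le> (y - x) \<bullet> (G y - G x)"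
    using assms unfolding mu_monotone_def op_single_def by auto
  moreover have "0 \<le> (\<mu>F + \<mu>G) * (norm (y - x))\<^sup>2" using assms by simp
  moreover have "(y - x) \<bullet> ((v + G y) - (v' + G x)) = (y - x) \<bullet> (v - v') + (y - x) \<bullet> (G y - G x)"
    by (simp add: inner_simps)
  ultimately show ?thesis by (simp add: distrib_right)
qed

text \<open>Monotonicity puts a zero into every half-space; conversely, a point of all half-spaces
  is monotonically related to the graph of \<open>F + G\<close> and hence a zero. The description
  shows closedness and convexity, and its relaxation drives the demiclosedness argument.\<close>

lemma zer_op_add_single_eq:
  fixes F :: "'a::{real_inner, complete_space} \<Rightarrow> 'a set"
  assumes F: "maximal_mu_monotone \<mu>F F" and G: "mu_monotone \<mu>G (op_single G)" "L-lipschitz_on UNIV G"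
    and "0 \<le> \<mu>F + \<mu>G"
  shows "zer (op_add F (op_single G)) = (\<Inter>(y, v)\<in>op_graph F. {x. (v + G y) \<bullet> x \<le> (v + G y) \<bullet> y})"
proof -
  have mono: "mu_monotone \<mu>F F" using F by (simp add: maximal_mu_monotone_def)
  have "x \<in> zer (op_add F (op_single G)) \<longleftrightarrow> (\<forall>y v. v \<in> F y \<longrightarrow> 0 \<le> (y - x) \<bullet> (v + G y))" for x
    using mem_zer_if_monotonically_related[OF F G(2), of x]
      op_add_single_monotone[where x=x and v'="- G x", OF mono G(1) assms(4)]
    by (auto simp: zer_op_add_single_iff)
  then show ?thesis by (auto simp: op_graph_def inner_diff_left inner_commute)
qed

lemma zer_op_add_single_closed_convex:
  fixes F :: "'a::{real_inner, complete_space} \<Rightarrow> 'a set"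
  assumes "maximal_mu_monotone \<mu>F F" "mu_monotone \<mu>G (op_single G)" "L-lipschitz_on UNIV G" "0 \<le> \<mu>F + \<mu>G"
  shows "closed (zer (op_add F (op_single G)))" "convex (zer (op_add F (op_single G)))"
  unfolding zer_op_add_single_eq[OF assms]
  by (auto intro!: closed_INT convex_INT closed_halfspace_le convex_halfspace_le)

text \<open>A quantitative form of the demiclosedness of the graph of \<open>F + G\<close>: otherwise the sets \<open>D \<sigma>\<close> below
  would have a common point, which would be a zero of \<open>F + G\<close> on the wrong side of \<open>p\<close>.\<close>

lemma approximate_zer_obtuse:
  fixes F :: "'a::{real_inner, complete_space} \<Rightarrow> 'a set"
  assumes F: "maximal_mu_monotone \<mu>F F" and G: "mu_monotone \<mu>G (op_single G)" "L-lipschitz_on UNIV G"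
    and \<mu>: "0 \<le> \<mu>F + \<mu>G"
    and p: "\<And>q. q \<in> zer (op_add F (op_single G)) \<Longrightarrow> (w - p) \<bullet> (q - p) \<le> 0"
    and e: "0 < e"
  shows "\<exists>\<sigma>>0. \<forall>x a. norm x \<le> R \<and> a - G x \<in> F x \<and> norm a \<le> \<sigma> \<longrightarrow> (w - p) \<bullet> (x - p) \<le> e"
proof (rule ccontr)
  assume neg: "\<not> ?thesis"
  have mono: "mu_monotone \<mu>F F" using F by (simp add: maximal_mu_monotone_def)
  \<comment> \<open>A counterexample \<open>x\<close> for \<open>\<sigma>\<close> lies in
    \<open>D \<sigma>\<close>: its perturbation \<open>a\<close> costs at most
    \<open>\<sigma> * norm (y - x)\<close>, which the relaxation
    \<open>\<sigma> * (norm y + R)\<close> covers. Being an intersection of a ball with half-spaces,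
    \<open>D \<sigma>\<close> is closed and convex.\<close>
  define D where "D = (\<lambda>\<sigma>. cball 0 R \<inter> {x. (w - p) \<bullet> x \<ge> (w - p) \<bullet> p + e} \<inter>
    (\<Inter>(y, v)\<in>op_graph F. {x. (v + G y) \<bullet> x \<le> (v + G y) \<bullet> y + \<sigma> * (norm y + R)}))"
  define K where "K = D ` {0<..}"
  \<comment> \<open>The negated claim provides points of norm at most \<open>R\<close>. The sign of
    \<open>R\<close> makes \<open>D\<close> increasing in \<open>\<sigma>\<close>.\<close>
  have R: "0 \<le> R"
  proof (rule ccontr)
    assume "\<not> 0 \<le> R"
    then have "\<not> norm x \<le> R" for x :: 'a using norm_ge_zero[of x] by linarith
    then show False using neg by (meson zero_less_one)
  qed
  have "\<Inter>K \<noteq> {}"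
  proof (rule directed_convex_Inter_nonempty[where R=R])
    show "K \<noteq> {}" by (auto simp: K_def)
  next
    fix A assume "A \<in> K"
    then obtain \<sigma> where \<sigma>: "0 < \<sigma>" "A = D \<sigma>" by (auto simp: K_def)
    obtain x a where x: "norm x \<le> R" "a - G x \<in> F x" "norm a \<le> \<sigma>" "e < (w - p) \<bullet> (x - p)"
      using neg \<sigma> by (meson not_le)
    have "(v + G y) \<bullet> x \<le> (v + G y) \<bullet> y + \<sigma> * (norm y + R)" if "v \<in> F y" for y v
    proof -
      have "0 \<le> (y - x) \<bullet> ((v + G y) - a)"
        using op_add_single_monotone[OF mono G(1) \<mu> that x(2)] by simp
      moreover have "\<bar>(y - x) \<bullet> a\<bar> \<le> (norm y + R) * \<sigma>"
      proof -
        have "\<bar>(y - x) \<bullet> a\<bar> \<le> norm (y - x) * norm a" by (rule Cauchy_Schwarz_ineq2)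
        also have "norm (y - x) \<le> norm y + R" using norm_triangle_ineq4[of y x] x(1) by linarith
        finally show ?thesis
          by (smt (verit) R mult_left_mono mult_right_mono norm_ge_zero x(3))
      qed
      ultimately show ?thesis
        by (simp add: inner_diff_left inner_diff_right inner_commute algebra_simps)
    qed
    then have "x \<in> A" using x by (auto simp: \<sigma> D_def op_graph_def inner_diff_right)
    moreover have "closed A" "convex A" unfolding \<sigma> D_def
      by (auto intro!: closed_Int convex_Int closed_INT convex_INT closed_halfspace_le convex_halfspace_le
          closed_halfspace_ge convex_halfspace_ge)
    ultimately show "closed A \<and> convex A \<and> A \<noteq> {} \<and> A \<subseteq> cball 0 R"
      unfolding \<sigma> D_def by blast
  next
    fix A B assume "A \<in> K" "B \<in> K"
    then obtain \<sigma> \<tau> where st: "0 < \<sigma>" "A = D \<sigma>" "0 < \<tau>" "B = D \<tau>" by (auto simp: K_def)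
    have "D \<sigma> \<subseteq> D \<tau>" if "\<sigma> \<le> \<tau>" for \<sigma> \<tau>
    proof
      fix x assume x: "x \<in> D \<sigma>"
      have "\<sigma> * (norm y + R) \<le> \<tau> * (norm y + R)" for y :: 'a
        using that R by (intro mult_right_mono) auto
      then show "x \<in> D \<tau>" using x unfolding D_def by (fastforce intro: order_trans)
    qed
    then have "D (min \<sigma> \<tau>) \<subseteq> A \<inter> B" using st by (metis Int_greatest min.cobounded1 min.cobounded2)
    then show "\<exists>C\<in>K. C \<subseteq> A \<inter> B" using st unfolding K_def by (metis greaterThan_iff imageI min_less_iff_conj)
  qed
  then obtain x where x: "\<And>\<sigma>. 0 < \<sigma> \<Longrightarrow> x \<in> D \<sigma>" by (auto simp: K_def)
  \<comment> \<open>As the relaxation tends to 0, the half-space description of the zeros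
    remains.\<close>
  have "(v + G y) \<bullet> x \<le> (v + G y) \<bullet> y" if "v \<in> F y" for y v
  proof -
    have "(v + G y) \<bullet> x - (v + G y) \<bullet> y \<le> r * (norm y + R)" if "0 < r" for r
    proof -
      have "(v + G y) \<bullet> x \<le> (v + G y) \<bullet> y + r * (norm y + R)"
        using x[OF that] \<open>v \<in> F y\<close> unfolding D_def op_graph_def by blast
      then show ?thesis by simp
    qed
    then have "(v + G y) \<bullet> x - (v + G y) \<bullet> y \<le> 0" by (rule nonpos_if_le_all_multiples)
    then show ?thesis by simp
  qed
  then have "x \<in> zer (op_add F (op_single G))"
    unfolding zer_op_add_single_eq[OF F G \<mu>] by (auto simp: op_graph_def)
  from p[OF this] show False using x[of 1] e by (simp add: D_def inner_diff_right)
qed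

subsection \<open>The energy of the iteration\<close>

text \<open>\<open>x\<close>, \<open>y\<close>, \<open>z\<close> stand for consecutive iterates,
  newest first, and \<open>g\<close> for \<open>\<gamma> (G x - G y)\<close>. The increment
  coefficients are tuned so that, with \<open>4 * \<eta> = 1 - 3 * \<theta> - 3 * t - 2 * q\<close>
  and weight 0 on the anchor, a step leaves margins \<open>2 * \<eta>\<close>,
  \<open>\<eta>\<close>, \<open>\<eta>\<close> for the three squared increments, newest
  first.\<close>

definition energy :: "real \<Rightarrow> real \<Rightarrow> real \<Rightarrow> real \<Rightarrow> 'a::real_inner \<Rightarrow> 'a \<Rightarrow> 'a \<Rightarrow> 'a \<Rightarrow> 'a \<Rightarrow> real" where
  "energy \<theta> t q \<eta> p g x y z =
     (norm (x - p))\<^sup>2 - \<theta> * (norm (y - p))\<^sup>2 + t * (norm (z - p))\<^sup>2 - 2 * (g \<bullet> (x - p))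
     + (2 * \<theta> + 2 * t + q + 2 * \<eta>) * (norm (x - y))\<^sup>2 + (t + \<eta>) * (norm (y - z))\<^sup>2"

lemma two_inner_le_if_norm_le:
  fixes x y g :: "'a::real_inner"
  assumes "norm g \<le> q * norm y" "0 \<le> q"
  shows "\<bar>2 * (g \<bullet> x)\<bar> \<le> q * ((norm y)\<^sup>2 + (norm x)\<^sup>2)"
proof -
  have "\<bar>g \<bullet> x\<bar> \<le> norm g * norm x" by (rule Cauchy_Schwarz_ineq2)
  also have "\<dots> \<le> q * norm y * norm x" using assms by (intro mult_right_mono) auto
  finally have "\<bar>2 * (g \<bullet> x)\<bar> \<le> q * (2 * (norm y * norm x))" by (simp add: abs_mult)
  also have "\<dots> \<le> q * ((norm y)\<^sup>2 + (norm x)\<^sup>2)"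
    using assms(2) sum_squares_bound[of "norm y" "norm x"] by (intro mult_left_mono) auto
  finally show ?thesis .
qed

text \<open>The negative term is bounded through
  \<open>|y - p|^2 \<le> 2 |x - p|^2 + 2 |x - y|^2\<close> and the product with \<open>g\<close> by
  Young's inequality; the part \<open>2 * \<theta> + q\<close> of the coefficient of
  \<open>|x - y|^2\<close> absorbs their cost.\<close>

lemma energy_lower_bound:
  assumes "0 \<le> \<theta>" "0 \<le> t" "0 \<le> q" "0 \<le> \<eta>" "norm g \<le> q * norm (x - y)"
  shows "(1 - 2 * \<theta> - q) * (norm (x - p))\<^sup>2 \<le> energy \<theta> t q \<eta> p g x y z"
proof -
  have "(norm (y - p))\<^sup>2 \<le> 2 * (norm (x - p))\<^sup>2 + 2 * (norm (x - y))\<^sup>2"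
  proof -
    have "2 * (norm (x - p))\<^sup>2 + 2 * (norm (x - y))\<^sup>2 - (norm (y - p))\<^sup>2 = (norm ((x - p) + (x - y)))\<^sup>2"
      by (simp add: power2_norm_eq_inner inner_simps inner_commute)
    then show ?thesis by (metis diff_ge_0_iff_ge zero_le_power2)
  qed
  then have "\<theta> * (norm (y - p))\<^sup>2 \<le> \<theta> * (2 * (norm (x - p))\<^sup>2 + 2 * (norm (x - y))\<^sup>2)"
    using assms by (intro mult_left_mono)
  moreover have "\<bar>2 * (g \<bullet> (x - p))\<bar> \<le> q * ((norm (x - y))\<^sup>2 + (norm (x - p))\<^sup>2)"
    using assms by (intro two_inner_le_if_norm_le)
  moreover have "0 \<le> t * (norm (z - p))\<^sup>2" "0 \<le> (2 * t + 2 * \<eta>) * (norm (x - y))\<^sup>2" "0 \<le> (t + \<eta>) * (norm (y - z))\<^sup>2"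
    using assms by auto
  ultimately show ?thesis unfolding energy_def by (simp add: algebra_simps)
qed

text \<open>\<open>H\<close> is the monotonicity test of the inclusion at \<open>x3\<close> against
  \<open>p\<close>. The difference of the two sides is an explicit sum of twice \<open>H\<close>,
  nonnegatively weighted Young inequalities and nonnegative multiples of squares; the product with
  \<open>g3\<close> cancels between \<open>H\<close> and the new energy.\<close>

lemma energy_step:
  fixes x3 :: "'a::real_inner"
  assumes par: "0 \<le> \<theta>" "0 \<le> t" "0 \<le> q" "0 < \<eta>" and \<eta>: "4 * \<eta> = 1 - 3 * \<theta> - 3 * t - 2 * q"
    and l: "0 \<le> l" "l \<le> \<eta> / 4"
    and g2: "norm g2 \<le> q * norm (x2 - x1)"
    and H: "0 \<le> (l *\<^sub>R (w - x3) + (1 - l) *\<^sub>R (x2 + \<theta> *\<^sub>R (x2 - x1) - t *\<^sub>R (x1 - x0) - x3)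
                + g3 - (1 - l) *\<^sub>R g2) \<bullet> (x3 - p)"
  shows "energy \<theta> t q \<eta> p g3 x3 x2 x1 \<le> (1 - l) * energy \<theta> t q \<eta> p g2 x2 x1 x0 + 2 * l * ((w - p) \<bullet> (x3 - p))
     - \<eta> / 2 * ((norm (x3 - x2))\<^sup>2 + (norm (x2 - x1))\<^sup>2 + (norm (x1 - x0))\<^sup>2)"
proof -
  define W d e3 e2 e1 where "W = w - p" "d = x2 - p" "e3 = x3 - x2" "e2 = x2 - x1" "e1 = x1 - x0"
  note defs = this
  have sub: "x3 - p = d + e3" "x2 - p = d" "x1 - p = d - e2" "x0 - p = d - e2 - e1"
    "x3 - x2 = e3" "x2 - x1 = e2" "x1 - x0 = e1" "w - p = W" "w - x3 = W - d - e3"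
    by (simp_all add: defs)
  \<comment> \<open>Names for the inner products turn the final identity into one of polynomials in
    real variables.\<close>
  define dd de3 de2 de1 e33 e22 e11 e32 e31 e21 where
    "dd = d \<bullet> d" "de3 = d \<bullet> e3" "de2 = d \<bullet> e2" "de1 = d \<bullet> e1" "e33 = e3 \<bullet> e3" "e22 = e2 \<bullet> e2"
    "e11 = e1 \<bullet> e1" "e32 = e3 \<bullet> e2" "e31 = e3 \<bullet> e1" "e21 = e2 \<bullet> e1"
  note atoms = this
  have comm: "e3 \<bullet> d = de3" "e2 \<bullet> d = de2" "e1 \<bullet> d = de1" "e2 \<bullet> e3 = e32" "e1 \<bullet> e3 = e31" "e1 \<bullet> e2 = e21"
    by (simp_all add: atoms inner_commute)
  define Wx g3x g2d g2e where "Wx = W \<bullet> (d + e3)" "g3x = g3 \<bullet> (d + e3)" "g2d = g2 \<bullet> d" "g2e = g2 \<bullet> e3"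
  note gs = this
  define m where "m = 1 - l"
  have \<theta>t: "\<theta> \<le> 1" "3 * t \<le> 1" "q \<le> 1" "4 * \<eta> \<le> 1" using par \<eta> by auto
  have m: "0 \<le> m" using l \<theta>t by (simp add: m_def)
  have H': "0 \<le> l * (Wx - (dd + 2 * de3 + e33)) + m * (\<theta> * (de2 + e32) - t * (de1 + e31) - de3 - e33)
      + g3x - m * (g2d + g2e)"
  proof -
    have "x2 + \<theta> *\<^sub>R e2 - t *\<^sub>R e1 - x3 = \<theta> *\<^sub>R e2 - t *\<^sub>R e1 - e3"
      by (simp add: defs(3))
    from H[unfolded sub this] show ?thesis
      unfolding gs m_def[symmetric]
      by (simp add: inner_add_left inner_add_right inner_diff_left comm atoms[symmetric] algebra_simps)
  qed
  have E3: "energy \<theta> t q \<eta> p g3 x3 x2 x1 = (dd + 2 * de3 + e33) - \<theta> * dd + t * (dd - 2 * de2 + e22) - 2 * g3x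
       + (2 * \<theta> + 2 * t + q + 2 * \<eta>) * e33 + (t + \<eta>) * e22"
    unfolding energy_def sub gs power2_norm_eq_inner
    by (simp add: inner_add_left inner_add_right inner_diff_left inner_diff_right comm atoms[symmetric])
  have E2: "energy \<theta> t q \<eta> p g2 x2 x1 x0 = dd - \<theta> * (dd - 2 * de2 + e22)
       + t * (dd + e22 + e11 - 2 * de2 - 2 * de1 + 2 * e21) - 2 * g2d
       + (2 * \<theta> + 2 * t + q + 2 * \<eta>) * e22 + (t + \<eta>) * e11"
    unfolding energy_def sub gs power2_norm_eq_inner
    by (simp add: inner_add_left inner_add_right inner_diff_left inner_diff_right comm atoms[symmetric] algebra_simps)
  have pos: "0 \<le> dd" "0 \<le> e33" "0 \<le> e22" "0 \<le> e11" by (simp_all add: atoms)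
  \<comment> \<open>These squares control the mixed products \<open>e21\<close>, \<open>e32\<close>
    and \<open>e31\<close>.\<close>
  have "0 \<le> (e2 + e1) \<bullet> (e2 + e1)" "0 \<le> (e3 - e2) \<bullet> (e3 - e2)" "0 \<le> (e3 + e1) \<bullet> (e3 + e1)" by simp_all
  then have i: "0 \<le> e22 + e11 + 2 * e21" "0 \<le> e33 + e22 - 2 * e32" "0 \<le> e33 + e11 + 2 * e31"
    by (simp_all add: inner_add_left inner_add_right inner_diff_left inner_diff_right comm atoms[symmetric])
  have X: "0 \<le> dd + 2 * de3 + e33"
  proof -
    have "0 \<le> (d + e3) \<bullet> (d + e3)" by simp
    then show ?thesis by (simp add: inner_add_left inner_add_right comm atoms[symmetric])
  qed
  \<comment> \<open>Since \<open>x1 - p = (x3 - p) - e3 - e2\<close>, its square is at most three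
    times the sum of the three squares. As \<open>3 * t \<le> 1\<close>, the term
    \<open>l |x3 - p|^2\<close> and \<open>l\<close> times two squared increments pay for the part
    \<open>l t |x1 - p|^2\<close> of the new energy.\<close>
  have "dd - 2 * de2 + e22 \<le> 3 * ((dd + 2 * de3 + e33) + e33 + e22)"
  proof -
    have "0 \<le> ((d + e3) + e3) \<bullet> ((d + e3) + e3)" "0 \<le> ((d + e3) + e2) \<bullet> ((d + e3) + e2)"
      "0 \<le> (e3 - e2) \<bullet> (e3 - e2)" by simp_all
    then show ?thesis
      by (simp add: inner_add_left inner_add_right inner_diff_left inner_diff_right comm atoms[symmetric])
  qed
  then have "t * (dd - 2 * de2 + e22) \<le> t * (3 * ((dd + 2 * de3 + e33) + e33 + e22))"
    using par by (intro mult_left_mono)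
  also have "\<dots> = (3 * t) * ((dd + 2 * de3 + e33) + e33 + e22)" by simp
  also have "\<dots> \<le> 1 * ((dd + 2 * de3 + e33) + e33 + e22)"
    using \<theta>t pos X by (intro mult_right_mono) auto
  finally have i5: "0 \<le> l * ((dd + 2 * de3 + e33) + e33 + e22 - t * (dd - 2 * de2 + e22))"
    using l by simp
  have "\<bar>2 * g2e\<bar> \<le> q * (e22 + e33)"
    using two_inner_le_if_norm_le[OF g2 par(3), of e3] by (simp add: sub gs atoms power2_norm_eq_inner)
  then have i4: "0 \<le> m * (q * (e22 + e33) + 2 * g2e)" using m by (intro mult_nonneg_nonneg) auto
  have i1: "0 \<le> m * t * (e22 + e11 + 2 * e21)" "0 \<le> m * \<theta> * (e33 + e22 - 2 * e32)"
    "0 \<le> m * t * (e33 + e11 + 2 * e31)" "0 \<le> l * \<theta> * dd"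
    using i m par l pos by simp_all
  have lA: "l * (1 - \<theta> - t - q) \<le> l * 1" "l * (2 * \<eta> + t) \<le> l * 1" "l * \<eta> \<le> (1/2) * \<eta>"
    using l par \<theta>t by (intro mult_left_mono mult_right_mono; simp)+
  \<comment> \<open>The losses caused by \<open>l\<close> are at most
    \<open>2 * l \<le> \<eta> / 2\<close> in each coefficient, so each margin
    \<open>2 * \<eta>\<close>, \<open>\<eta>\<close>, \<open>\<eta>\<close> still leaves
    \<open>\<eta> / 2\<close>.\<close>
  have c3: "0 \<le> m * (1 - \<theta> - t - q) - l - (2 * \<theta> + 2 * t + q + 2 * \<eta>) - \<eta> / 2"
    using lA l \<eta> by (simp add: m_def left_diff_distrib)
  have c2: "0 \<le> m * (2 * \<eta> + t) - l - (t + \<eta>) - \<eta> / 2"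
    using lA l \<eta> by (simp add: m_def left_diff_distrib)
  have c1: "0 \<le> m * \<eta> - \<eta> / 2"
    using lA by (simp add: m_def left_diff_distrib)
  have cs: "0 \<le> (m * (1 - \<theta> - t - q) - l - (2 * \<theta> + 2 * t + q + 2 * \<eta>) - \<eta> / 2) * e33"
    "0 \<le> (m * (2 * \<eta> + t) - l - (t + \<eta>) - \<eta> / 2) * e22" "0 \<le> (m * \<eta> - \<eta> / 2) * e11"
    using c1 c2 c3 pos by simp_all
  have "(1 - l) * energy \<theta> t q \<eta> p g2 x2 x1 x0 + 2 * l * ((w - p) \<bullet> (x3 - p))
     - \<eta> / 2 * ((norm (x3 - x2))\<^sup>2 + (norm (x2 - x1))\<^sup>2 + (norm (x1 - x0))\<^sup>2) - energy \<theta> t q \<eta> p g3 x3 x2 x1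
    = 2 * (l * (Wx - (dd + 2 * de3 + e33)) + m * (\<theta> * (de2 + e32) - t * (de1 + e31) - de3 - e33)
      + g3x - m * (g2d + g2e))
      + l * ((dd + 2 * de3 + e33) + e33 + e22 - t * (dd - 2 * de2 + e22))
      + m * (q * (e22 + e33) + 2 * g2e)
      + m * t * (e22 + e11 + 2 * e21) + m * \<theta> * (e33 + e22 - 2 * e32)
      + m * t * (e33 + e11 + 2 * e31) + l * \<theta> * dd
      + (m * (1 - \<theta> - t - q) - l - (2 * \<theta> + 2 * t + q + 2 * \<eta>) - \<eta> / 2) * e33
      + (m * (2 * \<eta> + t) - l - (t + \<eta>) - \<eta> / 2) * e22 + (m * \<eta> - \<eta> / 2) * e11"
    (is "?gap = ?terms")
    unfolding E3 E2 unfolding sub power2_norm_eq_inner gs(1)[symmetric] atoms(5-7)[symmetric] m_def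
    by (simp add: algebra_simps add_divide_distrib)
  moreover have "0 \<le> ?terms"
    by (intro add_nonneg_nonneg mult_nonneg_nonneg[OF zero_le_numeral H'] i5 i4 i1 cs)
  ultimately have "0 \<le> ?gap" by (simp only:)
  then show ?thesis by simp
qed

section \<open>Vanishing of the energy and strong convergence\<close>

text \<open>Beyond the level \<open>r / 2\<close>, the sequence shrinks by
  \<open>1 - l k \<le> exp (- l k)\<close> in each step. The accumulated factor
  \<open>exp (S K - S n)\<close> tends to 0 because the sums diverge.\<close>

lemma contraction_limit:
  fixes s l :: "nat \<Rightarrow> real"
  assumes s: "\<And>k. 0 \<le> s k" and l: "\<And>k. 0 \<le> l k" "\<And>k. l k \<le> 1"
    and div: "filterlim (\<lambda>n. \<Sum>k<n. l k) at_top sequentially"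
    and step: "\<And>e. 0 < e \<Longrightarrow> \<forall>\<^sub>F k in sequentially. s (Suc k) \<le> (1 - l k) * s k + l k * e"
  shows "s \<longlonglongrightarrow> 0"
proof (rule LIMSEQ_I)
  fix r :: real assume r: "0 < r"
  then obtain K where K: "\<And>k. k \<ge> K \<Longrightarrow> s (Suc k) \<le> (1 - l k) * s k + l k * (r / 2)"
    using step[of "r / 2"] unfolding eventually_sequentially by auto
  define S where "S = (\<lambda>n. \<Sum>k<n. l k)"
  have bound: "s n \<le> r / 2 + exp (S K - S n) * s K" if "n \<ge> K" for n
    using that
  proof (induction n rule: dec_induct)
    case base
    then show ?case using r by simp
  next
    case (step n)
    have "s (Suc n) \<le> (1 - l n) * s n + l n * (r / 2)" using K step by simp
    also have "\<dots> \<le> (1 - l n) * (r / 2 + exp (S K - S n) * s K) + l n * (r / 2)"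
      using step l[of n] by (intro add_right_mono mult_left_mono) auto
    also have "\<dots> = r / 2 + (1 - l n) * (exp (S K - S n) * s K)" by (simp add: field_simps)
    also have "\<dots> \<le> r / 2 + exp (- l n) * (exp (S K - S n) * s K)"
      using exp_ge_add_one_self[of "- l n"] s by (intro add_left_mono mult_right_mono) auto
    also have "\<dots> = r / 2 + exp (S K - S (Suc n)) * s K"
      by (simp add: S_def mult.assoc[symmetric] exp_add[symmetric])
    finally show ?case .
  qed
  have "filterlim (\<lambda>n. - S K + S n) at_top sequentially"
    using div unfolding S_def by (intro filterlim_tendsto_add_at_top[OF tendsto_const])
  then have "filterlim (\<lambda>n. S K - S n) at_bot sequentially"
    by (simp add: filterlim_uminus_at_bot)
  then have "((\<lambda>n. exp (S K - S n)) \<longlongrightarrow> 0) sequentially"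
    by (auto intro: filterlim_compose[OF exp_at_bot])
  then have "((\<lambda>n. exp (S K - S n) * s K) \<longlongrightarrow> 0 * s K) sequentially"
    by (intro tendsto_intros)
  then obtain N where N: "\<And>n. n \<ge> N \<Longrightarrow> exp (S K - S n) * s K < r / 2"
    using order_tendstoD(2)[of _ "0 * s K" sequentially "r / 2"] r unfolding eventually_sequentially by auto
  have "norm (s n - 0) < r" if "n \<ge> max K N" for n
    using bound[of n] N[of n] that s[of n] by auto
  then show "\<exists>no. \<forall>n\<ge>no. norm (s n - 0) < r" by blast
qed

theorem theorem3p1:
  fixes F :: "'a::{real_inner, complete_space} \<Rightarrow> 'a set"
    and G :: "'a \<Rightarrow> 'a"
    and \<mu>F \<mu>G L \<gamma> \<theta>1 \<theta>2 :: real
    and lam :: "nat \<Rightarrow> real"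
    and wstar :: 'a
    and u :: "int \<Rightarrow> 'a"
    and w :: "nat \<Rightarrow> 'a"
  assumes "L > 0" and "0 < \<gamma>" and "\<gamma> < 1 / (2 * L)"
    and "maximal_mu_monotone \<mu>F F"
    and "mu_monotone \<mu>G (op_single G)" and "L-lipschitz_on UNIV G"
    and "\<mu>F + \<mu>G \<ge> 0"
    and "zer (op_add F (op_single G)) \<noteq> {}"
    and "0 \<le> \<theta>1" and "\<theta>1 < 1 / 3 * (1 - 2 * \<gamma> * L)"
    and "1 / (3 + 4 * \<theta>1) * (3 * \<theta>1 - 1 + 2 * \<gamma> * L) < \<theta>2" and "\<theta>2 \<le> 0"
    and "1 + \<gamma> * \<mu>F > 0"
    and "\<And>k. k \<ge> 1 \<Longrightarrow> 0 < lam k \<and> lam k < 1"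
    and "lam \<longlonglongrightarrow> 0"
    and "filterlim (\<lambda>n. \<Sum>k=1..n. lam k) at_top sequentially"
    and "\<And>k. k \<ge> 1 \<Longrightarrow>
           w k = u (int k) + \<theta>1 *\<^sub>R (u (int k) - u (int k - 1))
                           + \<theta>2 *\<^sub>R (u (int k - 1) - u (int k - 2))"
    and "\<And>k. k \<ge> 1 \<Longrightarrow>
           u (int k + 1) = the_elem (resolvent (op_scale \<gamma> F)
             (lam k *\<^sub>R wstar + (1 - lam k) *\<^sub>R w k - \<gamma> *\<^sub>R G (u (int k))
                - (\<gamma> * (1 - lam k)) *\<^sub>R (G (u (int k)) - G (u (int k - 1)))))"
  shows "(\<lambda>k. u (int k)) \<longlonglongrightarrow> metric_proj (zer (op_add F (op_single G))) wstar"
proof -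
  note F = assms(4) and G = assms(5,6) and \<mu> = assms(7)
  have mono: "mu_monotone \<mu>F F" using F by (simp add: maximal_mu_monotone_def)
  define p where "p = metric_proj (zer (op_add F (op_single G))) wstar"
  note cc = zer_op_add_single_closed_convex[OF F G \<mu>]
  have p: "p \<in> zer (op_add F (op_single G))"
    and p_obtuse: "\<And>q. q \<in> zer (op_add F (op_single G)) \<Longrightarrow> (wstar - p) \<bullet> (q - p) \<le> 0"
    unfolding p_def using metric_proj_props[OF cc assms(8)] by auto
  define t q \<eta> where "t = - \<theta>2" "q = \<gamma> * L" "\<eta> = (1 - 3 * \<theta>1 - 3 * t - 2 * q) / 4"
  note tq = this
  have par: "0 \<le> \<theta>1" "0 \<le> t" "0 \<le> q" "0 \<le> \<gamma>" using assms by (auto simp: tq)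
  \<comment> \<open>Clearing the denominator in the lower bound for \<theta>2 shows that the slack
    \<open>4 * \<eta>\<close> exceeds \<open>4 * t * \<theta>1\<close>.\<close>
  have "3 * \<theta>1 - 1 + 2 * q < - t * (3 + 4 * \<theta>1)"
    using assms(9,11) by (simp add: tq pos_divide_less_eq mult.assoc)
  moreover have "0 \<le> t * \<theta>1" using par by simp
  ultimately have "0 < 1 - 3 * \<theta>1 - 3 * t - 2 * q" by (simp add: algebra_simps)
  then have \<eta>: "0 < \<eta>" "4 * \<eta> = 1 - 3 * \<theta>1 - 3 * t - 2 * q"
    by (simp_all add: tq(3))
  define \<kappa> where "\<kappa> = 1 - 2 * \<theta>1 - q"
  have \<kappa>: "0 < \<kappa>" using \<eta> par by (simp add: \<kappa>_def)
  \<comment> \<open>Shift to natural indices, with \<open>x 0 = u (-1)\<close>: for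
    \<open>k = n + 1\<close>, the vectors \<open>x n\<close> to \<open>x (n + 3)\<close> are
    \<open>u (k - 2)\<close> to \<open>u (k + 1)\<close>, and \<open>l n\<close> is
    \<open>lam k\<close>.\<close>
  define x where "x = (\<lambda>n. u (int n - 1))"
  define l where "l = (\<lambda>n. lam (Suc n))"
  define g where "g = (\<lambda>n. \<gamma> *\<^sub>R (G (x (n + 2)) - G (x (n + 1))))"
  have l: "0 \<le> l n" "l n \<le> 1" for n using assms(14)[of "Suc n"] by (auto simp: l_def)
  have l_lim: "l \<longlonglongrightarrow> 0" unfolding l_def using assms(15) by (rule LIMSEQ_Suc)
  have l_small: "\<forall>\<^sub>F n in sequentially. l n < e" if "0 < e" for e
    using order_tendstoD(2)[OF l_lim that] .
  have "(\<Sum>k=1..n. lam k) = (\<Sum>k<n. l k)" for n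
    by (simp add: l_def sum.atLeast_Suc_atMost_Suc_shift sum.atLeast1_atMost_eq)
  then have l_div: "filterlim (\<lambda>n. \<Sum>k<n. l k) at_top sequentially"
    using assms(16) by simp
  have g_bound: "norm (g n) \<le> q * norm (x (n + 2) - x (n + 1))" for n
  proof -
    have "norm (G (x (n + 2)) - G (x (n + 1))) \<le> L * norm (x (n + 2) - x (n + 1))"
      using lipschitz_onD[OF G(2), of "x (n + 2)" "x (n + 1)"] by (simp add: dist_norm)
    then show ?thesis using par by (simp add: g_def tq mult.assoc mult_left_mono)
  qed
  \<comment> \<open>\<open>r n / \<gamma>\<close> is the residual of \<open>x (n + 3)\<close> as an
    approximate zero of \<open>F + G\<close>: adding \<open>\<gamma> G (x (n + 3))\<close> to the
    resolvent equation creates \<open>g (Suc n)\<close>.\<close>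
  define r where "r = (\<lambda>n. l n *\<^sub>R (wstar - x (n + 3))
      + (1 - l n) *\<^sub>R (x (n + 2) + \<theta>1 *\<^sub>R (x (n + 2) - x (n + 1)) - t *\<^sub>R (x (n + 1) - x n) - x (n + 3))
      + g (Suc n) - (1 - l n) *\<^sub>R g n)"
  have r: "(1 / \<gamma>) *\<^sub>R r n - G (x (n + 3)) \<in> F (x (n + 3))" for n
  proof -
    define k where "k = Suc n"
    define z where "z = lam k *\<^sub>R wstar + (1 - lam k) *\<^sub>R w k - \<gamma> *\<^sub>R G (u (int k))
                - (\<gamma> * (1 - lam k)) *\<^sub>R (G (u (int k)) - G (u (int k - 1)))"
    have k: "1 \<le> k" by (simp add: k_def)
    have xs: "x (n + 3) = u (int k + 1)" "x (n + 2) = u (int k)" "x (n + 1) = u (int k - 1)" "x n = u (int k - 2)"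
      by (simp_all add: x_def k_def)
    have "u (int k + 1) \<in> resolvent (op_scale \<gamma> F) z"
      unfolding assms(18)[OF k] z_def[symmetric] using resolvent_single_valued[OF F assms(2,13), of z] by blast
    then have "(1 / \<gamma>) *\<^sub>R (z - x (n + 3)) \<in> F (x (n + 3))"
      using assms(2) by (simp add: mem_resolvent_op_scale_iff xs)
    moreover have "z - x (n + 3) = r n - \<gamma> *\<^sub>R G (x (n + 3))"
    proof -
      have g: "g (Suc n) = \<gamma> *\<^sub>R G (x (n + 3)) - \<gamma> *\<^sub>R G (u (int k))"
        "g n = \<gamma> *\<^sub>R (G (u (int k)) - G (u (int k - 1)))"
        using xs by (simp_all add: g_def scaleR_diff_right eval_nat_numeral)
      show ?thesis
        unfolding r_def z_def assms(17)[OF k] g unfolding xs tq l_def k_def[symmetric]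
        by (simp add: algebra_simps)
    qed
    ultimately show ?thesis using assms(2) by (simp add: scaleR_diff_right)
  qed
  define V where "V = (\<lambda>n. energy \<theta>1 t q \<eta> p (g n) (x (n + 2)) (x (n + 1)) (x n))"
  define \<Delta> where "\<Delta> = (\<lambda>n. (norm (x (n + 3) - x (n + 2)))\<^sup>2 + (norm (x (n + 2) - x (n + 1)))\<^sup>2
      + (norm (x (n + 1) - x n))\<^sup>2)"
  have lower: "\<kappa> * (norm (x (n + 2) - p))\<^sup>2 \<le> V n" for n
    unfolding \<kappa>_def V_def using par \<eta> g_bound by (intro energy_lower_bound) auto
  have lower': "\<kappa> * (norm (x (n + 3) - p))\<^sup>2 \<le> V (Suc n)" for n
    using lower[of "Suc n"] by (simp add: numeral_3_eq_3)
  have V0: "0 \<le> V n" for n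
    using lower[of n] \<kappa> by (smt (verit) mult_nonneg_nonneg zero_le_power2)
  have step: "V (Suc n) \<le> (1 - l n) * V n + 2 * l n * ((wstar - p) \<bullet> (x (n + 3) - p)) - \<eta> / 2 * \<Delta> n"
    if "l n \<le> \<eta> / 4" for n
  proof -
    have "0 \<le> (x (n + 3) - p) \<bullet> (((1 / \<gamma>) *\<^sub>R r n - G (x (n + 3)) + G (x (n + 3))) - (- G p + G p))"
      using p r by (intro op_add_single_monotone[OF mono G(1) \<mu>]) (auto simp: zer_op_add_single_iff)
    then have "0 \<le> r n \<bullet> (x (n + 3) - p)"
      using assms(2) by (simp add: zero_le_divide_iff inner_commute)
    from energy_step[OF par(1-3) \<eta> l(1) that g_bound this[unfolded r_def]]
    show ?thesis unfolding V_def \<Delta>_def by (simp add: eval_nat_numeral)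
  qed
  obtain N where N: "\<And>n. n \<ge> N \<Longrightarrow> l n \<le> \<eta> / 4"
    using l_small[of "\<eta> / 4"] \<eta> unfolding eventually_sequentially by (auto intro: less_imp_le)
  define W where "W = norm (wstar - p)"
  \<comment> \<open>\<open>M\<close> is an invariant bound: Young's inequality with weight
    \<open>\<kappa>\<close> bounds the anchor error by \<open>l n * (V (Suc n) / 2 + M / 2)\<close>,
    and the half of \<open>V (Suc n)\<close> moves to the left.\<close>
  define M where "M = max (V N) (4 / \<kappa> * W\<^sup>2)"
  have M: "V n \<le> M" if "n \<ge> N" for n
    using that
  proof (induction n rule: dec_induct)
    case base
    then show ?case by (simp add: M_def)
  next
    case (step n)
    define d where "d = norm (x (n + 3) - p)"
    have "2 * ((wstar - p) \<bullet> (x (n + 3) - p)) \<le> 2 * (W * d)"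
      using norm_cauchy_schwarz[of "wstar - p" "x (n + 3) - p"] by (simp add: W_def d_def)
    also have "\<dots> \<le> \<kappa> / 2 * d\<^sup>2 + 2 / \<kappa> * W\<^sup>2"
    proof -
      have "\<kappa> / 2 * d\<^sup>2 + 2 / \<kappa> * W\<^sup>2 - 2 * (W * d) = (\<kappa> * d - 2 * W)\<^sup>2 / (2 * \<kappa>)"
        using \<kappa> by (simp add: power2_eq_square field_simps)
      moreover have "0 \<le> (\<kappa> * d - 2 * W)\<^sup>2 / (2 * \<kappa>)" using \<kappa> by simp
      ultimately show ?thesis by linarith
    qed
    also have "\<dots> \<le> V (Suc n) / 2 + M / 2"
    proof -
      have "4 / \<kappa> * W\<^sup>2 \<le> M" "2 / \<kappa> * W\<^sup>2 = (4 / \<kappa> * W\<^sup>2) / 2" by (simp_all add: M_def)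
      moreover have "\<kappa> / 2 * d\<^sup>2 = \<kappa> * d\<^sup>2 / 2" by simp
      ultimately show ?thesis using lower'[of n] unfolding d_def by linarith
    qed
    finally have "l n * (2 * ((wstar - p) \<bullet> (x (n + 3) - p))) \<le> l n * (V (Suc n) / 2 + M / 2)"
      using l by (intro mult_left_mono)
    moreover have "0 \<le> \<eta> / 2 * \<Delta> n" using \<eta> by (simp add: \<Delta>_def)
    moreover have "(1 - l n) * V n \<le> (1 - l n) * M" using l[of n] step by (intro mult_left_mono) auto
    ultimately have "V (Suc n) \<le> (1 - l n) * M + l n * (V (Suc n) / 2 + M / 2)"
      using \<open>l n \<le> \<eta> / 4 \<Longrightarrow> _\<close>[OF N[OF step(1)]] by linarith
    then have "(1 - l n / 2) * V (Suc n) \<le> (1 - l n / 2) * M" by (simp add: algebra_simps)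
    moreover have "0 < 1 - l n / 2" using l[of n] by simp
    ultimately show ?case by simp
  qed
  define D where "D = sqrt (M / \<kappa>)"
  have D: "norm (x (n + 3) - p) \<le> D" if "n \<ge> N" for n
  proof -
    have "\<kappa> * (norm (x (n + 3) - p))\<^sup>2 \<le> M"
      using lower'[of n] M[of "Suc n"] that by linarith
    then show ?thesis unfolding D_def using \<kappa> by (intro real_le_rsqrt) (simp add: field_simps)
  qed
  have D0: "0 \<le> D" using D[of N] norm_ge_zero order_trans by blast
  have "V \<longlonglongrightarrow> 0"
  proof (rule contraction_limit[OF V0 l(1) l(2) l_div])
    fix e :: real assume e: "0 < e"
    \<comment> \<open>The tolerance is \<open>e / 2\<close> because the inner product enters the
      step doubled.\<close>
    obtain \<sigma> where \<sigma>: "0 < \<sigma>"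
      "\<And>y a. norm y \<le> D + norm p \<Longrightarrow> a - G y \<in> F y \<Longrightarrow> norm a \<le> \<sigma> \<Longrightarrow> (wstar - p) \<bullet> (y - p) \<le> e / 2"
      using approximate_zer_obtuse[OF F G \<mu> p_obtuse, of "e / 2" "D + norm p"] e by auto
    \<comment> \<open>If all three increments are at most \<open>\<gamma> * \<sigma> / 12\<close>,
      they contribute at most \<open>\<gamma> * \<sigma> / 2\<close> to
      \<open>norm (r n)\<close>.\<close>
    define \<tau> where "\<tau> = (\<gamma> * \<sigma> / 12)\<^sup>2"
    have \<tau>: "0 < \<tau>" using \<sigma> assms(2) by (simp add: \<tau>_def)
    have W0: "0 \<le> W" by (simp add: W_def)
    \<comment> \<open>\<open>ev1\<close> leaves less than the other half of
      \<open>\<gamma> * \<sigma>\<close> to the anchor term of \<open>r n\<close>;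
      \<open>ev2\<close> makes the error smaller than the gain
      \<open>\<eta> / 2 * \<tau>\<close>.\<close>
    have ev1: "\<forall>\<^sub>F n in sequentially. l n < \<gamma> * \<sigma> / 2 / (W + D + 1)"
      using \<sigma> assms(2) W0 D0 by (intro l_small) simp
    have ev2: "\<forall>\<^sub>F n in sequentially. l n < \<eta> / 2 * \<tau> / (2 * (W * D) + 1)"
      using \<tau> \<eta> W0 D0 by (intro l_small) (simp add: add_nonneg_pos)
    show "\<forall>\<^sub>F n in sequentially. V (Suc n) \<le> (1 - l n) * V n + l n * e"
      using ev1 ev2 eventually_ge_at_top[of N]
    proof eventually_elim
      case (elim n)
      note st = step[OF N[OF elim(3)]]
      have \<Delta>0: "0 \<le> \<eta> / 2 * \<Delta> n" using \<eta> by (simp add: \<Delta>_def)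
      show ?case
      proof (cases "(wstar - p) \<bullet> (x (n + 3) - p) \<le> e / 2")
        case True
        then have "l n * (2 * ((wstar - p) \<bullet> (x (n + 3) - p))) \<le> l n * e"
          using l by (intro mult_left_mono) auto
        then show ?thesis using st \<Delta>0 by linarith
      next
        case False
        define a b c where "a = norm (x (n + 3) - x (n + 2))" "b = norm (x (n + 2) - x (n + 1))"
          "c = norm (x (n + 1) - x n)"
        note abc = this
        have abc0: "0 \<le> a" "0 \<le> b" "0 \<le> c" by (simp_all add: abc)
        have "norm (x (n + 3)) \<le> D + norm p"
          using D[OF elim(3)] norm_triangle_ineq[of "x (n + 3) - p" p] by simp
        \<comment> \<open>By choice of \<open>\<sigma>\<close>, a point violating the angle bound
          has a large residual, which forces a large increment.\<close>
        then have "\<not> norm ((1 / \<gamma>) *\<^sub>R r n) \<le> \<sigma>"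
          using \<sigma>(2)[OF _ r] False by blast
        then have big: "\<gamma> * \<sigma> < norm (r n)" using assms(2) by (simp add: field_simps)
        have "norm (wstar - x (n + 3)) \<le> W + D"
          using D[OF elim(3)] norm_triangle_ineq4[of "wstar - p" "x (n + 3) - p"] by (simp add: W_def)
        then have t1: "norm (l n *\<^sub>R (wstar - x (n + 3))) \<le> l n * (W + D + 1)"
          using l(1)[of n] by (auto intro: mult_left_mono)
        define Q where "Q = l n * (W + D + 1)"
        have Q: "Q < \<gamma> * \<sigma> / 2"
          using elim(1) W0 D0 pos_less_divide_eq[of "W + D + 1" "l n" "\<gamma> * \<sigma> / 2"] by (simp add: Q_def)
        have small: "\<theta>1 \<le> 1" "t \<le> 1" "q \<le> 1" using par \<eta> by auto
        have shrink: "norm ((1 - l n) *\<^sub>R y) \<le> norm y" for y :: 'a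
          using l[of n] by (simp add: mult_left_le_one_le)
        define y where "y = x (n + 2) + \<theta>1 *\<^sub>R (x (n + 2) - x (n + 1)) - t *\<^sub>R (x (n + 1) - x n) - x (n + 3)"
        have "y = \<theta>1 *\<^sub>R (x (n + 2) - x (n + 1)) - t *\<^sub>R (x (n + 1) - x n) - (x (n + 3) - x (n + 2))"
          by (simp add: y_def)
        then have "norm y \<le> \<theta>1 * b + t * c + a"
          using norm_triangle_ineq4[of "\<theta>1 *\<^sub>R (x (n + 2) - x (n + 1)) - t *\<^sub>R (x (n + 1) - x n)" "x (n + 3) - x (n + 2)"]
            norm_triangle_ineq4[of "\<theta>1 *\<^sub>R (x (n + 2) - x (n + 1))" "t *\<^sub>R (x (n + 1) - x n)"] par
          by (simp add: abc)
        also have "\<dots> \<le> b + c + a"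
          using small par abc0 by (intro add_mono mult_left_le_one_le order_refl)
        finally have "norm y \<le> b + c + a" .
        moreover have "norm (g (Suc n)) \<le> a" "norm (g n) \<le> b"
        proof -
          have "norm (g (Suc n)) \<le> q * a" "norm (g n) \<le> q * b"
            using g_bound[of "Suc n"] g_bound[of n] by (simp_all add: abc eval_nat_numeral)
          moreover have "q * a \<le> a" "q * b \<le> b"
            using small par abc0 by (simp_all add: mult_left_le_one_le)
          ultimately show "norm (g (Suc n)) \<le> a" "norm (g n) \<le> b" by (blast intro: order_trans)+
        qed
        moreover have "norm (r n) \<le> Q + norm y + norm (g (Suc n)) + norm (g n)"
        proof -
          have "norm (r n) \<le> norm (l n *\<^sub>R (wstar - x (n + 3))) + norm ((1 - l n) *\<^sub>R y)
              + norm (g (Suc n)) + norm ((1 - l n) *\<^sub>R g n)"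
            unfolding r_def y_def[symmetric]
            by (smt (verit) norm_triangle_ineq norm_triangle_ineq4)
          also have "\<dots> \<le> Q + norm y + norm (g (Suc n)) + norm (g n)"
            by (intro add_mono t1[folded Q_def] shrink order_refl)
          finally show ?thesis .
        qed
        \<comment> \<open>\<open>y\<close> contributes \<open>a + b + c\<close> and the two
          \<open>g\<close> terms \<open>a + b\<close>.\<close>
        ultimately have "norm (r n) \<le> Q + 2 * (a + b + c)"
          using abc0 by argo
        then have "\<gamma> * \<sigma> / 12 < a \<or> \<gamma> * \<sigma> / 12 < b \<or> \<gamma> * \<sigma> / 12 < c"
          using big Q by argo
        moreover have "0 \<le> \<gamma> * \<sigma> / 12" using \<sigma> par by simp
        ultimately have "\<tau> \<le> a\<^sup>2 \<or> \<tau> \<le> b\<^sup>2 \<or> \<tau> \<le> c\<^sup>2"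
          unfolding \<tau>_def by (meson less_imp_le power_mono)
        then have "\<tau> \<le> \<Delta> n"
          using zero_le_power2[of a] zero_le_power2[of b] zero_le_power2[of c]
          unfolding \<Delta>_def abc[symmetric] by linarith
        then have "\<eta> / 2 * \<tau> \<le> \<eta> / 2 * \<Delta> n" using \<eta> by simp
        moreover have "2 * l n * ((wstar - p) \<bullet> (x (n + 3) - p)) \<le> \<eta> / 2 * \<tau>"
        proof -
          have "(wstar - p) \<bullet> (x (n + 3) - p) \<le> W * norm (x (n + 3) - p)"
            unfolding W_def by (rule norm_cauchy_schwarz)
          also have "\<dots> \<le> W * D" using W0 D[OF elim(3)] by (rule mult_left_mono[rotated])
          finally have "2 * l n * ((wstar - p) \<bullet> (x (n + 3) - p)) \<le> 2 * l n * (W * D)"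
            using l(1)[of n] by (intro mult_left_mono) auto
          also have "\<dots> \<le> l n * (2 * (W * D) + 1)" using l(1)[of n] by (simp add: algebra_simps)
          also have "\<dots> < \<eta> / 2 * \<tau>"
          proof -
            have "0 < 2 * (W * D) + 1" using W0 D0 by (simp add: add_nonneg_pos)
            then show ?thesis using iffD1[OF pos_less_divide_eq elim(2)] by blast
          qed
          finally show ?thesis by simp
        qed
        moreover have "0 \<le> l n * e" using l e by simp
        ultimately show ?thesis using st by linarith
      qed
    qed
  qed
  then have "(\<lambda>n. sqrt (V n / \<kappa>)) \<longlonglongrightarrow> sqrt (0 / \<kappa>)"
    by (intro tendsto_intros) (use \<kappa> in auto)
  then have lim: "(\<lambda>n. sqrt (V n / \<kappa>)) \<longlonglongrightarrow> 0" by simp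
  have "norm (x (n + 2) - p) \<le> sqrt (V n / \<kappa>)" for n
    using lower[of n] \<kappa> by (intro real_le_rsqrt) (simp add: field_simps)
  then have "(\<lambda>n. x (n + 2) - p) \<longlonglongrightarrow> 0"
    by (intro Lim_null_comparison[OF _ lim]) auto
  then have "(\<lambda>n. x (n + 2)) \<longlonglongrightarrow> p" by (simp only: LIM_zero_iff)
  \<comment> \<open>Back to the original indices: \<open>x (n + 2)\<close> is
    \<open>u (n + 1)\<close>.\<close>
  then have "(\<lambda>n. u (int (Suc n))) \<longlonglongrightarrow> p" by (simp add: x_def)
  then show ?thesis unfolding p_def by (rule LIMSEQ_imp_Suc)
qed

end
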